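(* In the online resource allocation problem with resource-independent rewards and sizes described in the context, suppose the regularity assumption on the distribution functions $F_i$ holds and let $$\hat K=\left\lceil\frac{\sum_{j=1}^mc_j}{\sum_{i=1}^np_i\int_0^{r_i\bar\omega/r_{\max}}w\,dF_i(w)}\right\rceil,\qquad r_{\max}=\max\{r_1,\dots,r_n\}.$$ Then the adaptive threshold policy $\text{ATP}_2$ satisfies $$\text{Regret}(\text{ATP}_2)\le(\log T+1)\cdot(2mM-m)\cdot r_{\max}+r_{\max}\cdot\hat K=O(m\log T).$$
   Context: **Problem.** There are $m$ resources with initial capacities $\mathbf c=(c_1,\dots,c_m)$ and $T$ periods. In period $t$ one request arrives with a nonnegative reward and a positive size; requests are drawn independently across periods from a known distribution that does not depend on $t$. After seeing the request the decision maker irrevocably rejects it or serves it with one resource. **Resource-independent request distribution.** With probability $p_i$ ($i=1,\dots,n$) the reward of the request is $r_i$ whichever resource serves it, and then its size is $u_i$ whichever resource serves it, where $u_i$ is a one-dimensional random variable with distribution function $F_i$. So serving a request $(r_i,u_i)$ with resource $j$ yields reward $r_i$ and consumes $u_i$ units of resource $j$. **Regret.** Denote the reward and size of request $t$ by $r^t$, $d^t$ and $\mathbf I=\{(r^t,d^t)\}_{t=1}^T$. A feasible policy $\pi$ chooses $x^\pi_j(t)\in\{0,1\}$ depending only on requests $1,\dots,t$, with $\sum_td^tx^\pi_j(t)\le c_j$ for all $j$ and $\sum_jx^\pi_j(t)\le1$ for all $t$; $V^\pi(\mathbf I)=\sum_t\sum_jr^tx^\pi_j(t)$. The prophet value $V^{\text{off}}(\mathbf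 I)$ is the maximum of $\sum_t\sum_jr^tx^t_j$ over $x^t_j\in\{0,1\}$ with $\sum_td^tx^t_j\le c_j$ for all $j$ and $\sum_jx^t_j\le1$ for all $t$. $\text{Regret}(\pi)=\mathbb E[V^{\text{off}}(\mathbf I)]-\mathbb E[V^\pi(\mathbf I)]$. **Regularity assumption on $F_i$.** For some $\bar\omega>0$ and for all $i$, $F_i$ has a continuous density $f_i$ and: (1) there exist a constant $0<\lambda<1$ and two constants $1<\gamma_1<\gamma_2$ such that $\gamma_1F_i(\lambda w)\le F_i(w)\le\gamma_2F_i(\lambda w)$ for all $w\in(0,\bar\omega)$; (2) $w\mapsto w^3f_i(w)$ is non-decreasing on $(0,\bar\omega)$. **Constant $M$.** $M>1$ is the constant, existing under condition (1), such that $\frac{w_2(F_i(w_2)-F_i(w_1))}{\int_{w_1}^{w_2}w\,dF_i(w)}\le M$ for all $i$ and all $0<w_1<w_2<\bar\omega$. **Policy $\text{ATP}_2$.** In period $t$, with remaining capacities $\mathbf c^t=(c^t_1,\dots,c^t_m)$ ($\mathbf c^1=\mathbf c$), let $\mu_t(\mathbf c^t)$ solve $$\sum_{i=1}^np_i\int_0^{r_i\mu_t(\mathbf c^t)}w\,dF_i(w)=\frac{\sum_{j=1}^mc^t_j}{T-t+1},$$ with $\mu_t(\mathbf c^t)=+\infty$ if there is no solution. Let $j_t$ be the resource with the largest remaining capacity, $c^t_{j_t}=\max_jc^t_j$, and $h^i_t(\mathbf c^t)=\min\{c^t_{j_t},\,r_i\mu_t(\mathbf c^t)\}$ for each $i$.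 When the request is revealed as $(r_i,u_i)$, serve it with resource $j_t$ if $u_i\le h^i_t(\mathbf c^t)$, and reject it if $u_i>h^i_t(\mathbf c^t)$. *)

theory Defs
  imports "HOL-Probability.Probability"
begin

text \<open>
  Resources are indexed by \<open>j < m\<close>, periods by \<open>t \<in> {1..T}\<close>, request classes by a finite
  type. A request is a pair (reward, size). The law of the size of a request of class \<open>i\<close> is
  a probability measure \<open>S i\<close> on the reals; its distribution function is \<open>cdf (S i)\<close>.
\<close>

type_synonym request = "real \<times> real"

definition request_law ::
  "'n pmf \<Rightarrow> ('n \<Rightarrow> real) \<Rightarrow> ('n \<Rightarrow> real measure) \<Rightarrow> request measure" where
  "request_law p r S = measure_pmf p \<bind> (\<lambda>i. distr (S i) borel (\<lambda>u. (r i, u)))"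

definition feasible_allocation ::
  "nat \<Rightarrow> nat \<Rightarrow> (nat \<Rightarrow> real) \<Rightarrow> (nat \<Rightarrow> request) \<Rightarrow> (nat \<Rightarrow> nat \<Rightarrow> real) \<Rightarrow> bool" where
  "feasible_allocation m T c I x \<longleftrightarrow>
     (\<forall>t\<in>{1..T}. \<forall>j<m. x t j \<in> {0, 1}) \<and>
     (\<forall>j<m. (\<Sum>t=1..T. snd (I t) * x t j) \<le> c j) \<and>
     (\<forall>t\<in>{1..T}. (\<Sum>j<m. x t j) \<le> 1)"

definition allocation_value ::
  "nat \<Rightarrow> nat \<Rightarrow> (nat \<Rightarrow> request) \<Rightarrow> (nat \<Rightarrow> nat \<Rightarrow> real) \<Rightarrow> real" where
  "allocation_value m T I x = (\<Sum>t=1..T. \<Sum>j<m. fst (I t) * x t j)"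

definition prophet_value :: "nat \<Rightarrow> nat \<Rightarrow> (nat \<Rightarrow> real) \<Rightarrow> (nat \<Rightarrow> request) \<Rightarrow> real" where
  "prophet_value m T c I = Max {allocation_value m T I x |x. feasible_allocation m T c I x}"

text \<open>
  A policy is given as the map from the request sequence to the allocation it produces.
\<close>

definition regret ::
  "request measure \<Rightarrow> nat \<Rightarrow> nat \<Rightarrow> (nat \<Rightarrow> real) \<Rightarrow>
   ((nat \<Rightarrow> request) \<Rightarrow> nat \<Rightarrow> nat \<Rightarrow> real) \<Rightarrow> real" where
  "regret Q m T c \<pi> =
     (\<integral>I. prophet_value m T c I \<partial>(\<Pi>\<^sub>M t\<in>{1..T}. Q)) -
     (\<integral>I. allocation_value m T I (\<pi> I) \<partial>(\<Pi>\<^sub>M t\<in>{1..T}. Q))"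

definition regular_size_law :: "real \<Rightarrow> real measure \<Rightarrow> bool" where
  "regular_size_law \<omega> N \<longleftrightarrow>
     (\<exists>f. f \<in> borel_measurable borel \<and> (\<forall>w. 0 \<le> f w) \<and>
        N = density lborel (\<lambda>w. ennreal (f w)) \<and>
        continuous_on {0<..} f \<and>
        (\<exists>l \<gamma>1 \<gamma>2. 0 < l \<and> l < 1 \<and> 1 < \<gamma>1 \<and> \<gamma>1 < \<gamma>2 \<and>
           (\<forall>w\<in>{0<..<\<omega>}. \<gamma>1 * cdf N (l * w) \<le> cdf N w \<and> cdf N w \<le> \<gamma>2 * cdf N (l * w))) \<and>
        mono_on {0<..<\<omega>} (\<lambda>w. w ^ 3 * f w))"

text \<open>
  Expected amount consumed by one request when class \<open>i\<close> is served iff its size is at most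
  \<open>r i * x\<close>.
\<close>

definition mean_consumption ::
  "'n::finite pmf \<Rightarrow> ('n \<Rightarrow> real) \<Rightarrow> ('n \<Rightarrow> real measure) \<Rightarrow> real \<Rightarrow> real" where
  "mean_consumption p r S x = (\<Sum>i\<in>UNIV. pmf p i * (LINT w:{0..r i * x}|S i. w))"

definition r_max :: "('n::finite \<Rightarrow> real) \<Rightarrow> real" where
  "r_max r = Max (range r)"

definition K_hat ::
  "'n::finite pmf \<Rightarrow> ('n \<Rightarrow> real) \<Rightarrow> ('n \<Rightarrow> real measure) \<Rightarrow> real \<Rightarrow> nat \<Rightarrow> (nat \<Rightarrow> real) \<Rightarrow> int" where
  "K_hat p r S \<omega> m c = \<lceil>(\<Sum>j<m. c j) / mean_consumption p r S (\<omega> / r_max r)\<rceil>"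

text \<open>
  \<open>\<mu> t b\<close> is the multiplier in period \<open>t\<close> at remaining capacities \<open>b\<close>. The equation may have
  several solutions; any measurable selection is admitted.
\<close>

definition ATP2_multiplier ::
  "'n::finite pmf \<Rightarrow> ('n \<Rightarrow> real) \<Rightarrow> ('n \<Rightarrow> real measure) \<Rightarrow> nat \<Rightarrow> nat \<Rightarrow>
   (nat \<Rightarrow> (nat \<Rightarrow> real) \<Rightarrow> ereal) \<Rightarrow> bool" where
  "ATP2_multiplier p r S m T \<mu> \<longleftrightarrow>
     (\<forall>t\<in>{1..T}. \<mu> t \<in> borel_measurable borel \<and>
        (\<forall>b. (\<forall>j<m. 0 \<le> b j) \<longrightarrow>
           (let sol = {x. 0 \<le> x \<and> mean_consumption p r S x = (\<Sum>j<m. b j) / real (T - t + 1)}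
            in if sol = {} then \<mu> t b = \<infinity> else \<mu> t b \<in> ereal ` sol)))"

text \<open>
  \<open>J t b\<close> is a resource with the largest remaining capacity; ties are broken by an arbitrary
  measurable rule.
\<close>

definition largest_resource :: "nat \<Rightarrow> nat \<Rightarrow> (nat \<Rightarrow> (nat \<Rightarrow> real) \<Rightarrow> nat) \<Rightarrow> bool" where
  "largest_resource m T J \<longleftrightarrow>
     (\<forall>t\<in>{1..T}. J t \<in> borel \<rightarrow>\<^sub>M count_space UNIV \<and>
        (\<forall>b. J t b < m \<and> b (J t b) = Max (b ` {..<m})))"

text \<open>
  In \<open>ereal\<close> we have \<open>0 * \<infinity> = 0\<close>: for an infinite multiplier the threshold of a class with
  zero reward is zero.
\<close>

definition ATP2_accepts ::
  "(nat \<Rightarrow> (nat \<Rightarrow> real) \<Rightarrow> ereal) \<Rightarrow> (nat \<Rightarrow> (nat \<Rightarrow> real) \<Rightarrow> nat) \<Rightarrow> nat \<Rightarrow> (nat \<Rightarrow> real) \<Rightarrow>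
   request \<Rightarrow> bool" where
  "ATP2_accepts \<mu> J t b q \<longleftrightarrow> ereal (snd q) \<le> min (ereal (b (J t b))) (ereal (fst q) * \<mu> t b)"

text \<open>Capacities that remain after the first \<open>t\<close> periods, that is, at the start of period \<open>t + 1\<close>.\<close>

primrec ATP2_capacity ::
  "(nat \<Rightarrow> (nat \<Rightarrow> real) \<Rightarrow> ereal) \<Rightarrow> (nat \<Rightarrow> (nat \<Rightarrow> real) \<Rightarrow> nat) \<Rightarrow> (nat \<Rightarrow> real) \<Rightarrow>
   (nat \<Rightarrow> request) \<Rightarrow> nat \<Rightarrow> nat \<Rightarrow> real" where
  "ATP2_capacity \<mu> J c I 0 = c"
| "ATP2_capacity \<mu> J c I (Suc t) =
     (let b = ATP2_capacity \<mu> J c I t; j = J (Suc t) b in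
      if ATP2_accepts \<mu> J (Suc t) b (I (Suc t)) then b(j := b j - snd (I (Suc t))) else b)"

definition ATP2 ::
  "(nat \<Rightarrow> (nat \<Rightarrow> real) \<Rightarrow> ereal) \<Rightarrow> (nat \<Rightarrow> (nat \<Rightarrow> real) \<Rightarrow> nat) \<Rightarrow> (nat \<Rightarrow> real) \<Rightarrow>
   (nat \<Rightarrow> request) \<Rightarrow> nat \<Rightarrow> nat \<Rightarrow> real" where
  "ATP2 \<mu> J c I t j =
     (let b = ATP2_capacity \<mu> J c I (t - 1) in
      if j = J t b \<and> ATP2_accepts \<mu> J t b (I t) then 1 else 0)"

end

theory Submission
  imports Defs "HOL-Analysis.Harmonic_Numbers"
begin

text \<open>
  Let \<open>R x\<close> be the mean consumption of one request if class \<open>i\<close> is served up to size \<open>r i * x\<close>, and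
  \<open>G x\<close> the mean reward of the same rule. Raising \<open>x\<close> adds requests of size \<open>r i * x\<close> and reward
  \<open>r i\<close>, so \<open>G' = R' / x\<close>. Hence the fluid value \<open>g (R x) = G x\<close>, the reward per period that a
  budget of \<open>R x\<close> per period can buy, is a concave function \<open>g\<close> with slope \<open>1 / x\<close> at \<open>R x\<close>. Pricing
  capacity at this slope shows that the prophet with \<open>k\<close> periods and total capacity \<open>C\<close> gains at
  most \<open>k * g (C / k)\<close> in expectation (\<open>expected_prophet_le_fluid\<close>).

  The policy is compared with the same potential. One period turns \<open>k * g (C / k)\<close> into a reward
  plus \<open>(k - 1) * g ((C - Y) / (k - 1))\<close>, where \<open>Y\<close> is the consumption. Put \<open>\<rho> = C / k\<close> and
  \<open>R \<mu> = \<rho>\<close>. As long as no threshold is truncated by the largest capacity, \<open>Y\<close> has mean \<open>\<rho>\<close>, and the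
  terms of first order cancel. The loss is the expected gap between \<open>g\<close> and its tangent at \<open>\<rho>\<close>, at
  distance \<open>(Y - \<rho>) / (k - 1)\<close> and multiplied by \<open>k - 1\<close>.

  Monotonicity of \<open>w ^ 3 * f i w\<close> means that the curvature of \<open>g\<close> decreases along the curve. The gap
  divided by the squared distance is therefore largest at the budget 0, where the gap equals
  \<open>G \<mu> - \<rho> / \<mu> \<le> (M - 1) * \<rho> / \<mu>\<close> by the definition of \<open>M\<close>. This quadratic bound
  (\<open>quadratic_gap\<close>, \<open>fluid_value_gap\<close>) together with a second moment estimate for \<open>Y\<close> yields a loss of
  order \<open>1 / k\<close> per period. If the largest capacity, which is at least \<open>C / m\<close>, does truncate
  a threshold, then \<open>\<rho> / \<mu> \<le> m * r_max / k\<close>, and the whole period is worth only \<open>M\<close> times this much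
  (\<open>one_step\<close>).

  The losses add up to a harmonic sum, hence to \<open>ln T + 1\<close>. The estimate requires that the
  budget per period stays below \<open>R (\<omega> / r_max)\<close>, where the regularity assumption applies; it does
  so until only \<open>K_hat\<close> periods are left, and each of these costs at most \<open>r_max\<close>.
\<close>

section \<open>The concave fluid curve and its quadratic tangent gap\<close>

text \<open>
  \<open>R x\<close> and \<open>G x\<close> are the mean consumption and the mean reward of one period at multiplier
  \<open>x\<close>. The relation \<open>G' = R' / x\<close> says that the curve \<open>R x \<mapsto> G x\<close> has slope \<open>1 / x\<close>, hence
  is concave with second derivative \<open>- 1 / (x ^ 3 * a x)\<close>; so \<open>cube_mono\<close> is the statement
  that the curvature decreases in absolute value along the curve.
\<close>
locale fluid_curve =
  fixes a G R :: "real \<Rightarrow> real" and X M :: real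
  assumes X_pos: "0 < X"
    and G_cont: "continuous_on {0..} G" and R_cont: "continuous_on {0..} R"
    and G_0: "G 0 = 0" and R_0: "R 0 = 0"
    and G_deriv: "\<And>x. 0 < x \<Longrightarrow> (G has_real_derivative a x) (at x)"
    and R_deriv: "\<And>x. 0 < x \<Longrightarrow> (R has_real_derivative x * a x) (at x)"
    and a_nonneg: "\<And>x. 0 < x \<Longrightarrow> 0 \<le> a x"
    and a_pos: "\<And>x. 0 < x \<Longrightarrow> x < X \<Longrightarrow> 0 < a x"
    and cube_mono: "\<And>x y. 0 < x \<Longrightarrow> x \<le> y \<Longrightarrow> y < X \<Longrightarrow> x ^ 3 * a x \<le> y ^ 3 * a y"
    and reward_per_use: "\<And>x. 0 < x \<Longrightarrow> x < X \<Longrightarrow> x * G x \<le> M * R x"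
begin

lemma R_cont_on: "0 \<le> u \<Longrightarrow> continuous_on {u..v} R"
  by (rule continuous_on_subset[OF R_cont]) auto

lemma G_cont_on: "0 \<le> u \<Longrightarrow> continuous_on {u..v} G"
  by (rule continuous_on_subset[OF G_cont]) auto

lemma R_mono: "0 \<le> x \<Longrightarrow> x \<le> y \<Longrightarrow> R x \<le> R y"
proof (rule DERIV_nonneg_imp_increasing_open[where f = R])
  fix z assume "0 \<le> x" "x < z" "z < y"
  then show "\<exists>d. (R has_real_derivative d) (at z) \<and> 0 \<le> d"
    using R_deriv[of z] a_nonneg[of z] by (intro exI[of _ "z * a z"]) auto
qed (auto intro: R_cont_on)

lemma G_mono: "0 \<le> x \<Longrightarrow> x \<le> y \<Longrightarrow> G x \<le> G y"
proof (rule DERIV_nonneg_imp_increasing_open[where f = G])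
  fix z assume "0 \<le> x" "x < z" "z < y"
  then show "\<exists>d. (G has_real_derivative d) (at z) \<and> 0 \<le> d"
    using G_deriv[of z] a_nonneg[of z] by (intro exI[of _ "a z"]) auto
qed (auto intro: G_cont_on)

lemma R_strict_mono:
  assumes "0 \<le> x" "x < y" "y \<le> X" shows "R x < R y"
proof (rule DERIV_pos_imp_increasing_open[where f = R, OF \<open>x < y\<close>])
  fix z assume "x < z" "z < y"
  then show "\<exists>d. (R has_real_derivative d) (at z) \<and> 0 < d"
    using R_deriv[of z] a_pos[of z] assms by (intro exI[of _ "z * a z"]) auto
qed (use assms R_cont_on in auto)

lemma R_pos: "0 < x \<Longrightarrow> x \<le> X \<Longrightarrow> 0 < R x"
  using R_strict_mono[of 0 x] by (simp add: R_0)

lemma R_less_iff: "0 \<le> x \<Longrightarrow> R x < R X \<Longrightarrow> x < X"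
  using R_mono[of X x] X_pos by (meson linorder_not_le less_imp_le)

text \<open>
  The left side is the gap between the concave curve and its tangent at \<open>R \<mu>\<close>. Because the
  curvature decreases to the right, the gap divided by the squared distance to the point of
  tangency is largest at the left end of the curve. The hypothesis on \<open>\<kappa>\<close> is the claim at
  that end, \<open>x = 0\<close>, and it implies the claim for every \<open>x\<close> on either side of \<open>\<mu>\<close>.
\<close>
lemma quadratic_gap:
  assumes \<mu>: "0 < \<mu>" "\<mu> < X" and x: "0 \<le> x" "x \<le> X"
    and \<kappa>: "G \<mu> - R \<mu> / \<mu> \<le> \<kappa> * (R \<mu>)\<^sup>2"
  shows "G \<mu> - G x - (R \<mu> - R x) / \<mu> \<le> \<kappa> * (R \<mu> - R x)\<^sup>2"
proof (rule ccontr)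
  \<comment> \<open>\<open>D' = R' * E\<close>, and \<open>E'\<close> has the sign of \<open>2 * \<kappa> * x ^ 3 * a x - 1\<close>, which by \<open>cube_mono\<close>
    can change only once, from negative to positive. With \<open>E \<mu> = 0\<close> and \<open>D \<mu> = 0 \<le> D 0\<close> this
    excludes negative values of \<open>D\<close>.\<close>
  define D where "D = (\<lambda>x. \<kappa> * (R \<mu> - R x)\<^sup>2 - (G \<mu> - G x - (R \<mu> - R x) / \<mu>))"
  define E where "E = (\<lambda>x. 1 / x - 1 / \<mu> - 2 * \<kappa> * (R \<mu> - R x))"
  assume "\<not> ?thesis"
  then have neg: "D x < 0" by (simp add: D_def)
  have D_0: "0 \<le> D 0" and D_\<mu>: "D \<mu> = 0" and E_\<mu>: "E \<mu> = 0"
    using \<kappa> by (simp_all add: D_def E_def G_0 R_0)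
  have D_deriv: "(D has_real_derivative z * a z * E z) (at z)" if "0 < z" for z
    unfolding D_def E_def using \<mu> that
    by (auto intro!: derivative_eq_intros G_deriv R_deriv simp: field_simps power2_eq_square)
  have E_deriv: "(E has_real_derivative (2 * \<kappa> * (z ^ 3 * a z) - 1) / z\<^sup>2) (at z)" if "0 < z" for z
    unfolding E_def using \<mu> that
    by (auto intro!: derivative_eq_intros R_deriv simp: field_simps power2_eq_square power3_eq_cube)
  have D_cont: "continuous_on {u..v} D" if "0 \<le> u" for u v
    unfolding D_def using that \<mu> by (intro continuous_intros R_cont_on G_cont_on) auto
  have D_mvt: "\<exists>z. u < z \<and> z < v \<and> D v - D u = (v - u) * (z * a z * E z)" if "0 \<le> u" "u < v" for u v
  proof -
    have "D differentiable (at z)" if "u < z" for z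
      using D_deriv[of z] that \<open>0 \<le> u\<close> by (auto simp: real_differentiable_def)
    then obtain l z where z: "u < z" "z < v" "(D has_real_derivative l) (at z)" "D v - D u = (v - u) * l"
      using MVT[OF \<open>u < v\<close> D_cont[OF \<open>0 \<le> u\<close>]] by blast
    moreover have "l = z * a z * E z" using DERIV_unique[OF z(3) D_deriv] z \<open>0 \<le> u\<close> by simp
    ultimately show ?thesis by blast
  qed
  have E_mvt: "\<exists>z. u < z \<and> z < v \<and> E v - E u = (v - u) * ((2 * \<kappa> * (z ^ 3 * a z) - 1) / z\<^sup>2)" if "0 < u" "u < v" for u v
    by (rule MVT2[OF \<open>u < v\<close> E_deriv]) (use \<open>0 < u\<close> in simp)
  consider "x = 0" | "0 < x" "x < \<mu>" | "x = \<mu>" | "\<mu> < x" using x by linarith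
  then show False
  proof cases
    case 1 then show ?thesis using neg D_0 by simp
  next
    case 3 then show ?thesis using neg D_\<mu> by simp
  next
    case 2
    \<comment> \<open>Left of \<open>\<mu>\<close>, \<open>D\<close> would fall and rise again, so \<open>E\<close> would be negative at some \<open>y\<close> and
      positive at a later \<open>z\<close>. Then \<open>E\<close> increases from \<open>z\<close> on and cannot vanish at \<open>\<mu>\<close>.\<close>
    obtain y where y: "0 < y" "y < x" "D x - D 0 = (x - 0) * (y * a y * E y)" using D_mvt[of 0 x] 2 by auto
    obtain z where z: "x < z" "z < \<mu>" "D \<mu> - D x = (\<mu> - x) * (z * a z * E z)" using D_mvt[of x \<mu>] 2 by auto
    have "(x * (y * a y)) * E y < 0" using y neg D_0 by (simp add: mult.assoc)
    moreover have "0 \<le> x * (y * a y)" using y 2 a_nonneg[of y] by simp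
    ultimately have Ey: "E y < 0" by (smt (verit) mult_nonneg_nonneg)
    have "0 < ((\<mu> - x) * (z * a z)) * E z" using z neg D_\<mu> by (simp add: mult.assoc)
    moreover have "0 \<le> (\<mu> - x) * (z * a z)" using z 2 a_nonneg[of z] by simp
    ultimately have Ez: "0 < E z" by (simp add: zero_less_mult_iff)
    obtain w where w: "y < w" "w < z" "E z - E y = (z - y) * ((2 * \<kappa> * (w ^ 3 * a w) - 1) / w\<^sup>2)"
      using E_mvt[of y z] y z by auto
    have "0 < (z - y) * ((2 * \<kappa> * (w ^ 3 * a w) - 1) / w\<^sup>2)" using w(3) Ey Ez by linarith
    then have kw: "1 < 2 * \<kappa> * (w ^ 3 * a w)" using w y
      by (simp add: zero_less_mult_iff zero_less_divide_iff)
    obtain v where v: "z < v" "v < \<mu>" "E \<mu> - E z = (\<mu> - z) * ((2 * \<kappa> * (v ^ 3 * a v) - 1) / v\<^sup>2)"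
      using E_mvt[of z \<mu>] y z by auto
    have "0 < w ^ 3 * a w" using a_pos[of w] w y z \<mu> by simp
    then have "0 < \<kappa>" using kw
      by (smt (verit) mult_nonpos_nonneg)
    then have "2 * \<kappa> * (w ^ 3 * a w) \<le> 2 * \<kappa> * (v ^ 3 * a v)"
      using cube_mono[of w v] w v y \<mu> by simp
    then have "0 \<le> (\<mu> - z) * ((2 * \<kappa> * (v ^ 3 * a v) - 1) / v\<^sup>2)" using kw z by simp
    then show ?thesis using v(3) Ez E_\<mu> by linarith
  next
    case 4
    \<comment> \<open>Right of \<open>\<mu>\<close>, \<open>E\<close> would fall below \<open>E \<mu> = 0\<close>. Then \<open>E\<close> decreases all the way up to \<open>\<mu>\<close>,
      so \<open>D\<close> increases strictly on \<open>{0..\<mu>}\<close>, against \<open>D 0 \<ge> D \<mu>\<close>.\<close>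
    obtain y where y: "\<mu> < y" "y < x" "D x - D \<mu> = (x - \<mu>) * (y * a y * E y)" using D_mvt[of \<mu> x] \<mu> 4 by auto
    have "((x - \<mu>) * (y * a y)) * E y < 0" using y neg D_\<mu> by (simp add: mult.assoc)
    moreover have "0 \<le> (x - \<mu>) * (y * a y)" using y \<mu> a_nonneg[of y] by simp
    ultimately have Ey: "E y < 0" by (smt (verit) mult_nonneg_nonneg)
    obtain w where w: "\<mu> < w" "w < y" "E y - E \<mu> = (y - \<mu>) * ((2 * \<kappa> * (w ^ 3 * a w) - 1) / w\<^sup>2)"
      using E_mvt[of \<mu> y] y \<mu> by auto
    have "(y - \<mu>) * ((2 * \<kappa> * (w ^ 3 * a w) - 1) / w\<^sup>2) < 0" using w(3) Ey E_\<mu> by linarith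
    then have kw: "2 * \<kappa> * (w ^ 3 * a w) < 1" using w y \<mu>
      by (simp add: mult_less_0_iff divide_less_0_iff)
    obtain z where z: "0 < z" "z < \<mu>" "D \<mu> - D 0 = (\<mu> - 0) * (z * a z * E z)" using D_mvt[of 0 \<mu>] \<mu> by auto
    obtain v where v: "z < v" "v < \<mu>" "E \<mu> - E z = (\<mu> - z) * ((2 * \<kappa> * (v ^ 3 * a v) - 1) / v\<^sup>2)"
      using E_mvt[of z \<mu>] z by auto
    have v0: "0 < v ^ 3 * a v" using a_pos[of v] v z \<mu> by simp
    have "v ^ 3 * a v \<le> w ^ 3 * a w" using cube_mono[of v w] v z w y x by simp
    then have "2 * \<kappa> * (v ^ 3 * a v) < 1"
      using kw v0 by (cases "0 \<le> \<kappa>") (smt (verit) mult_left_mono mult_nonpos_nonneg)+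
    then have "(\<mu> - z) * ((2 * \<kappa> * (v ^ 3 * a v) - 1) / v\<^sup>2) < 0" using v z
      by (simp add: mult_less_0_iff divide_less_0_iff)
    then have "0 < E z" using v(3) E_\<mu> by linarith
    then have "0 < \<mu> * (z * a z * E z)" using z a_pos[of z] \<mu> by simp
    then show ?thesis using z D_0 D_\<mu> by simp
  qed
qed

text \<open>
  The argument is clamped to the range of \<open>R\<close> on \<open>{0..X}\<close>; this makes the function continuous
  on the whole line, and thus Borel measurable.
\<close>
definition fluid_value :: "real \<Rightarrow> real" where
  "fluid_value \<rho> = G (the_inv_into {0..X} R (max 0 (min \<rho> (R X))))"

lemma R_inj: "inj_on R {0..X}"
  using R_strict_mono by (intro linorder_inj_onI) (auto, fastforce)

lemma R_image: "R ` {0..X} = {0..R X}"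
proof safe
  fix x assume "x \<in> {0..X}"
  then show "R x \<in> {0..R X}" using R_mono[of 0 x] R_mono[of x X] by (auto simp: R_0)
next
  fix y assume "y \<in> {0..R X}"
  then show "y \<in> R ` {0..X}"
    using IVT'[of R 0 y X] X_pos R_cont_on[of 0 X] by (auto simp: R_0)
qed

lemma obtain_multiplier:
  assumes "0 \<le> \<rho>" "\<rho> \<le> R X" obtains x where "0 \<le> x" "x \<le> X" "R x = \<rho>"
  using assms R_image by (metis atLeastAtMost_iff imageE)

lemma fluid_value_R: "0 \<le> x \<Longrightarrow> x \<le> X \<Longrightarrow> fluid_value (R x) = G x"
  using R_mono[of 0 x] R_mono[of x X] by (simp add: fluid_value_def R_0 the_inv_into_f_f[OF R_inj])

lemma fluid_value_cont: "continuous_on UNIV fluid_value"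
proof -
  have 1: "continuous_on {0..R X} (the_inv_into {0..X} R)"
    using continuous_on_inv_into[OF R_cont_on compact_Icc R_inj] R_image by simp
  have 2: "the_inv_into {0..X} R ` {0..R X} = {0..X}"
    using the_inv_into_onto[OF R_inj] R_image by simp
  have 3: "continuous_on {0..R X} (\<lambda>\<rho>. G (the_inv_into {0..X} R \<rho>))"
    by (rule continuous_on_compose2[OF G_cont 1]) (use 2 in auto)
  have "0 \<le> R X" using R_pos X_pos by force
  then show ?thesis unfolding fluid_value_def
    by (intro continuous_on_compose2[OF 3]) (auto intro!: continuous_intros)
qed

lemma fluid_value_bounds: "0 \<le> fluid_value \<rho> \<and> fluid_value \<rho> \<le> G X"
proof -
  have "0 \<le> R X" using R_pos X_pos by force
  then obtain x where x: "0 \<le> x" "x \<le> X" "R x = max 0 (min \<rho> (R X))" 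
    using obtain_multiplier[of "max 0 (min \<rho> (R X))"] by auto
  have "fluid_value \<rho> = G x"
    unfolding fluid_value_def x(3)[symmetric] using x by (subst the_inv_into_f_f[OF R_inj]) auto
  then show ?thesis using x G_mono[of 0 x] G_mono[of x X] by (simp add: G_0)
qed

text \<open>
  The tangent gap at the left end is \<open>G \<mu> - R \<mu> / \<mu>\<close>, which \<open>reward_per_use\<close> bounds by
  \<open>(M - 1) * R \<mu> / \<mu>\<close>; this is where the constant of the quadratic bound comes from.
\<close>
lemma fluid_value_gap:
  assumes \<mu>: "0 < \<mu>" "\<mu> < X" and s: "0 \<le> s" "s \<le> R X"
  shows "G \<mu> - fluid_value s - (R \<mu> - s) / \<mu> \<le> (M - 1) / (\<mu> * R \<mu>) * (R \<mu> - s)\<^sup>2"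
proof -
  obtain x where x: "0 \<le> x" "x \<le> X" "R x = s" using obtain_multiplier[OF s] .
  have Rp: "0 < R \<mu>" using R_pos \<mu> by simp
  have "G \<mu> - R \<mu> / \<mu> \<le> (M - 1) * R \<mu> / \<mu>"
    using reward_per_use[OF \<mu>] \<mu> by (simp add: field_simps)
  also have "\<dots> = (M - 1) / (\<mu> * R \<mu>) * (R \<mu>)\<^sup>2" using Rp \<mu> by (simp add: field_simps power2_eq_square)
  finally show ?thesis
    using quadratic_gap[OF \<mu> x(1,2), of "(M - 1) / (\<mu> * R \<mu>)"] x fluid_value_R[of x] by metis
qed

end

section \<open>Truncated moments of a size distribution\<close>

lemma cont_at_0_right:
  fixes g :: "real \<Rightarrow> real"
  assumes "\<And>x. 0 < x \<Longrightarrow> (g has_real_derivative g' x) (at x)" "(g \<longlongrightarrow> g 0) (at_right 0)"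
  shows "continuous_on {0..} g"
  unfolding continuous_on_def
proof
  fix x :: real assume "x \<in> {0..}"
  show "(g \<longlongrightarrow> g x) (at x within {0..})"
  proof (cases "x = 0")
    case True
    have "at (0::real) within {0..} = at_right 0"
      by (rule at_within_nhd[of _ UNIV]) auto
    then show ?thesis using True assms(2) by simp
  next
    case False
    then have "0 < x" using \<open>x \<in> {0..}\<close> by simp
    then have "isCont g x" using assms(1) DERIV_isCont by blast
    then show ?thesis unfolding isCont_def by (rule tendsto_within_subset) simp
  qed
qed

locale positive_size = real_distribution N for N :: "real measure" +
  fixes f :: "real \<Rightarrow> real"
  assumes size_pos: "AE u in N. 0 < u"
    and f_meas [measurable]: "f \<in> borel_measurable borel"
    and f_nonneg: "\<And>w. 0 \<le> f w"
    and N_density: "N = density lborel (\<lambda>w. ennreal (f w))"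
    and f_cont: "continuous_on {0<..} f"
begin

definition partial_mean :: "real \<Rightarrow> real" where "partial_mean x = (LINT w:{0..x}|N. w)"

lemma integrable_bounded_part:
  assumes [measurable]: "A \<in> sets borel" and A: "A \<subseteq> {a..b}"
  shows "set_integrable N A (\<lambda>w. w)"
  unfolding set_integrable_def
proof (rule integrable_const_bound)
  show "AE x in N. norm (indicator A x *\<^sub>R x) \<le> \<bar>a\<bar> + \<bar>b\<bar>"
  proof (rule AE_I2)
    fix x
    have "x \<in> A \<Longrightarrow> a \<le> x \<and> x \<le> b" using A by auto
    then show "norm (indicator A x *\<^sub>R x) \<le> \<bar>a\<bar> + \<bar>b\<bar>" by (cases "x \<in> A") auto
  qed
  show "(\<lambda>x. indicator A x *\<^sub>R x) \<in> borel_measurable N"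
    by measurable
qed

text \<open>
  The density may be unbounded near 0. The integral over \<open>{0..<a}\<close> for some \<open>0 < a < x\<close> is
  therefore split off as a constant, and the fundamental theorem is applied to the right of \<open>a\<close>.
\<close>
lemma integral_Icc_deriv:
  fixes h :: "real \<Rightarrow> real"
  assumes h_meas: "h \<in> borel_measurable borel" and h_cont: "continuous_on {0<..} h"
    and h_int: "\<And>b. set_integrable N {0..b} h" and x: "0 < x"
  shows "((\<lambda>x. LINT w:{0..x}|N. h w) has_real_derivative h x * f x) (at x)"
proof -
  define a b where "a = x / 2" and "b = x + 1"
  have ab: "0 < a" "a < x" "x < b" using x by (auto simp: a_def b_def)
  have hf: "continuous_on {a..y} (\<lambda>w. f w * h w)" for y
    using ab by (intro continuous_on_mult continuous_on_subset[OF f_cont] continuous_on_subset[OF h_cont]) auto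
  have split: "(LINT w:{0..y}|N. h w) = (LINT w:{0..<a}|N. h w) + integral {a..y} (\<lambda>w. f w * h w)"
    if "a \<le> y" for y
  proof -
    have "{0..y} = {0..<a} \<union> {a..y}" using that ab by auto
    then have "(LINT w:{0..y}|N. h w) = (LINT w:{0..<a}|N. h w) + (LINT w:{a..y}|N. h w)"
      using ab that by (simp only:)
        (intro set_integral_Un set_integrable_subset[OF h_int[of y]], auto)
    moreover have "(LINT w:{a..y}|N. h w) = (LINT w:{a..y}|lborel. f w * h w)"
      unfolding N_density set_lebesgue_integral_def using h_meas f_nonneg
      by (subst integral_density) (auto simp: mult.left_commute intro!: Bochner_Integration.integral_cong)
    moreover have "\<dots> = integral {a..y} (\<lambda>w. f w * h w)"
      by (intro set_borel_integral_eq_integral(2) borel_integrable_atLeastAtMost' hf)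
    ultimately show ?thesis by simp
  qed
  have "((\<lambda>y. integral {a..y} (\<lambda>w. f w * h w)) has_real_derivative f x * h x) (at x within {a..b})"
    using ab by (intro integral_has_real_derivative hf) auto
  then have "((\<lambda>y. integral {a..y} (\<lambda>w. f w * h w)) has_real_derivative f x * h x) (at x)"
    using at_within_Icc_at[OF ab(2,3)] by simp
  then have deriv: "((\<lambda>y. (LINT w:{0..<a}|N. h w) + integral {a..y} (\<lambda>w. f w * h w))
      has_real_derivative h x * f x) (at x)"
    using DERIV_add[OF DERIV_const[of "LINT w:{0..<a}|N. h w"]] by (simp add: mult.commute)
  have "\<forall>\<^sub>F y in nhds x. a < y"
    using ab by (intro order_tendstoD(1)[of "\<lambda>y. y"]) (auto intro: tendsto_ident_at filterlim_ident)
  then have "\<forall>\<^sub>F y in nhds x. (LINT w:{0..<a}|N. h w) + integral {a..y} (\<lambda>w. f w * h w)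
      = (LINT w:{0..y}|N. h w)"
    by eventually_elim (simp add: split)
  then show ?thesis by (rule DERIV_cong_ev[OF refl _ refl, THEN iffD1, OF _ deriv])
qed

lemma measure_nonpos: "measure N {..0} = 0"
proof -
  have "AE u in N. u \<notin> {..0}" using size_pos by eventually_elim auto
  then have "{..0} \<in> null_sets N" by (subst AE_iff_null_sets) auto
  then show ?thesis by (simp add: measure_eq_0_null_sets)
qed

lemma cdf_nonpos: "x \<le> 0 \<Longrightarrow> cdf N x = 0"
  using cdf_nondecreasing[of x 0] cdf_nonneg[of x] measure_nonpos by (simp add: cdf_def measure_le_0_iff)

lemma cdf_eq_integral: "cdf N x = (LINT w:{0..x}|N. 1)"
proof -
  have "AE u in N. (u \<in> {..x}) = (u \<in> {0..x})" using size_pos by eventually_elim auto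
  then have "measure N {..x} = measure N {0..x}"
    by (intro finite_measure_eq_AE) auto
  then show ?thesis by (simp add: cdf_def set_lebesgue_integral_def)
qed

lemma cdf_deriv: "0 < x \<Longrightarrow> (cdf N has_real_derivative f x) (at x)"
proof -
  assume "0 < x"
  have "((\<lambda>x. LINT w:{0..x}|N. 1) has_real_derivative 1 * f x) (at x)"
    by (intro integral_Icc_deriv \<open>0 < x\<close>) (auto simp: set_integrable_def emeasure_eq_measure)
  then show ?thesis by (simp add: cdf_eq_integral[abs_def])
qed

lemma partial_mean_deriv: "0 < x \<Longrightarrow> (partial_mean has_real_derivative x * f x) (at x)"
proof -
  assume "0 < x"
  have "((\<lambda>x. LINT w:{0..x}|N. w) has_real_derivative x * f x) (at x)"
    by (intro integral_Icc_deriv \<open>0 < x\<close> integrable_bounded_part) auto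
  then show ?thesis by (simp add: partial_mean_def[abs_def])
qed

lemma Icc_integral_mono:
  assumes "0 \<le> v" shows "(LINT w:{v..x}|N. w) \<le> partial_mean x" and "0 \<le> (LINT w:{v..x}|N. w)"
    and "(LINT w:{v..x}|N. w) \<le> x * measure N {v..x}" and "v * measure N {v..x} \<le> (LINT w:{v..x}|N. w)"
proof -
  have i: "integrable N (\<lambda>w. indicator {v..x} w *\<^sub>R w)" for v
    using integrable_bounded_part[of "{v..x}" v x] by (simp add: set_integrable_def)
  show "(LINT w:{v..x}|N. w) \<le> partial_mean x"
    unfolding partial_mean_def set_lebesgue_integral_def using assms
    by (intro integral_mono i) (auto simp: less_top[symmetric] split: split_indicator)
  show "0 \<le> (LINT w:{v..x}|N. w)"
    unfolding set_lebesgue_integral_def using assms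
    by (intro integral_nonneg_AE AE_I2) (auto simp: indicator_def)
  have "(LINT w:{v..x}|N. w) \<le> (\<integral>w. x * indicator {v..x} w \<partial>N)"
    unfolding set_lebesgue_integral_def using assms
    by (intro integral_mono i) (auto simp: less_top[symmetric] split: split_indicator)
  then show "(LINT w:{v..x}|N. w) \<le> x * measure N {v..x}" by simp
  have "(\<integral>w. v * indicator {v..x} w \<partial>N) \<le> (LINT w:{v..x}|N. w)"
    unfolding set_lebesgue_integral_def using assms
    by (intro integral_mono i) (auto simp: less_top[symmetric] split: split_indicator)
  then show "v * measure N {v..x} \<le> (LINT w:{v..x}|N. w)" by simp
qed

lemma partial_mean_nonneg: "0 \<le> partial_mean x" and partial_mean_le: "0 \<le> x \<Longrightarrow> partial_mean x \<le> x * cdf N x"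
  using Icc_integral_mono[of 0 x] by (auto simp: partial_mean_def cdf_eq_integral set_lebesgue_integral_def)

lemma partial_mean_0: "partial_mean 0 = 0"
  using partial_mean_nonneg[of 0] partial_mean_le[of 0] by simp

lemma cdf_cont: "continuous_on {0..} (cdf N)"
  using cdf_is_right_cont[of 0] by (intro cont_at_0_right[OF cdf_deriv]) (auto simp: continuous_within)

lemma partial_mean_cont: "continuous_on {0..} partial_mean"
proof (rule cont_at_0_right[OF partial_mean_deriv])
  have "((\<lambda>x. x * cdf N x) \<longlongrightarrow> 0 * cdf N 0) (at_right 0)"
    using cdf_is_right_cont[of 0] by (intro tendsto_mult) (auto simp: continuous_within tendsto_ident_at)
  then have upper: "((\<lambda>x. x * cdf N x) \<longlongrightarrow> 0) (at_right 0)" by simp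
  have "\<forall>\<^sub>F x in at_right 0. partial_mean x \<le> x * cdf N x"
    using eventually_at_right_less[of "0::real"] by eventually_elim (simp add: partial_mean_le)
  then have "(partial_mean \<longlongrightarrow> 0) (at_right 0)"
    using partial_mean_nonneg by (intro tendsto_sandwich[OF _ _ tendsto_const upper]) auto
  then show "(partial_mean \<longlongrightarrow> partial_mean 0) (at_right 0)" by (simp add: partial_mean_0)
qed simp

text \<open>
  If the density vanished at \<open>x\<close>, then it would vanish on \<open>{0<..x}\<close>, since \<open>w ^ 3 * f w\<close> is
  non-decreasing; the doubling inequality carries \<open>cdf N = 0\<close> from there to all of \<open>{0<..b}\<close>,
  against \<open>0 < partial_mean b\<close>.
\<close>
lemma density_pos:
  assumes "0 < l" "l < 1"
    and doubling: "\<And>w. 0 < w \<Longrightarrow> w < \<omega> \<Longrightarrow> cdf N w \<le> \<gamma> * cdf N (l * w)"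
    and cube: "mono_on {0<..<\<omega>} (\<lambda>w. w ^ 3 * f w)"
    and b: "0 < partial_mean b" "b \<le> \<omega>" and x: "0 < x" "x < b"
  shows "0 < f x"
proof (rule ccontr)
  assume "\<not> 0 < f x"
  then have fx: "f x = 0" using f_nonneg[of x] by simp
  have z: "f w = 0" if "0 < w" "w \<le> x" for w
  proof -
    have "w ^ 3 * f w \<le> x ^ 3 * f x" using that x b by (intro mono_onD[OF cube]) auto
    then show ?thesis using fx f_nonneg[of w] that by (simp add: mult_le_0_iff)
  qed
  have cx: "cdf N x = 0"
  proof -
    have "AE u in N. u \<notin> {0<..x}"
      unfolding N_density by (subst AE_density) (auto simp: z)
    then have "AE u in N. u \<notin> {..x}" using size_pos by eventually_elim auto
    then have "{..x} \<in> null_sets N" by (subst AE_iff_null_sets) auto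
    then show ?thesis by (simp add: measure_eq_0_null_sets cdf_def)
  qed
  have small: "cdf N w = 0" if "0 < w" "w < \<omega>" "l ^ n * w \<le> x" for n w
    using that
  proof (induction n arbitrary: w)
    case 0
    then show ?case using cdf_nondecreasing[of w x] cdf_nonneg[of w] cx by simp
  next
    case (Suc n)
    have "l * w < \<omega>" using Suc.prems assms(1,2) by (smt (verit) mult_less_cancel_right1)
    then have "cdf N (l * w) = 0"
      using Suc.prems assms(1) by (intro Suc.IH) (auto simp: mult.assoc mult.left_commute)
    then show ?case using doubling[of w] Suc.prems cdf_nonneg[of w] by simp
  qed
  have all: "cdf N w = 0" if w: "0 < w" "w < \<omega>" for w
  proof -
    have "0 < x / w" using x w by simp
    then obtain n where "l ^ n < x / w" using real_arch_pow_inv assms(2) by blast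
    then show ?thesis using w by (intro small[of w n]) (auto simp: field_simps)
  qed
  have "isCont (cdf N) b" using x DERIV_isCont[OF cdf_deriv] by simp
  then have "(cdf N \<longlongrightarrow> cdf N b) (at_left b)"
    by (simp add: isCont_def filterlim_at_split)
  moreover have "\<forall>\<^sub>F w in at_left b. cdf N w = 0"
    using eventually_at_left_real[OF less_trans[OF x]]
  proof eventually_elim
    case (elim w)
    then show ?case using b(2) by (intro all) auto
  qed
  ultimately have "((\<lambda>_. 0) \<longlongrightarrow> cdf N b) (at_left b)"
    by (rule Lim_transform_eventually)
  then have "cdf N b = 0"
    by (metis tendsto_const tendsto_unique trivial_limit_at_left_real)
  then show False using partial_mean_le[of b] b x by simp
qed

text \<open>
  This is the limit of the assumed ratio bound as the lower end of the interval tends to 0.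
\<close>
lemma size_times_cdf_le:
  assumes ratio: "\<And>v. 0 < v \<Longrightarrow> v < w \<Longrightarrow> w * (cdf N w - cdf N v) / (LINT u:{v..w}|N. u) \<le> M"
    and w: "0 < w" and M: "0 \<le> M"
  shows "w * cdf N w \<le> M * partial_mean w"
proof -
  have *: "w * (cdf N w - cdf N v) \<le> M * partial_mean w" if "0 < v" "v < w" for v
  proof -
    let ?L = "LINT u:{v..w}|N. u"
    have L: "0 \<le> ?L" "?L \<le> partial_mean w" "v * measure N {v..w} \<le> ?L"
      using Icc_integral_mono[of v w] that by auto
    have "cdf N w - cdf N v \<le> measure N {v..w}"
      unfolding cdf_diff_eq[OF \<open>v < w\<close>] by (intro finite_measure_mono) auto
    then have "v * (cdf N w - cdf N v) \<le> ?L" using L(3) that by (meson mult_left_mono less_imp_le order_trans)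
    \<comment> \<open>If the integral is 0, the ratio bound carries no information (division by 0 gives 0), but then
      the increment of the distribution function is 0 as well.\<close>
    then have "w * (cdf N w - cdf N v) \<le> M * ?L"
      using ratio[OF that] L(1) that w
      by (cases "?L = 0") (auto simp: divide_le_eq mult_le_0_iff split: if_splits)
    also have "\<dots> \<le> M * partial_mean w" using L M by (intro mult_left_mono) auto
    finally show ?thesis .
  qed
  have "((\<lambda>v. w * (cdf N w - cdf N v)) \<longlongrightarrow> w * (cdf N w - cdf N 0)) (at_right 0)"
    using cdf_is_right_cont[of 0] by (intro tendsto_intros) (auto simp: continuous_within)
  moreover have "\<forall>\<^sub>F v in at_right 0. w * (cdf N w - cdf N v) \<le> M * partial_mean w"
    using eventually_at_right_real[OF w] by eventually_elim (auto intro!: *)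
  ultimately have "w * (cdf N w - cdf N 0) \<le> M * partial_mean w"
    by (intro tendsto_upperbound) auto
  then show ?thesis by (simp add: cdf_nonpos)
qed

end

section \<open>The fluid curve of the request classes\<close>

definition mean_reward ::
  "'n::finite pmf \<Rightarrow> ('n \<Rightarrow> real) \<Rightarrow> ('n \<Rightarrow> real measure) \<Rightarrow> real \<Rightarrow> real" where
  "mean_reward p r S x = (\<Sum>i\<in>UNIV. pmf p i * (r i * cdf (S i) (r i * x)))"

text \<open>
  The witnesses in the regularity assumption, the size densities \<open>f\<close> and the doubling constants
  \<open>l\<close> and \<open>\<gamma>\<close>, become parameters, so that the slope of the fluid curve can be written down.
\<close>
locale request_classes =
  fixes p :: "'n::finite pmf"
    and r :: "'n \<Rightarrow> real"
    and S :: "'n \<Rightarrow> real measure"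
    and f :: "'n \<Rightarrow> real \<Rightarrow> real"
    and l \<gamma> :: "'n \<Rightarrow> real"
    and \<omega> M :: real
  assumes r_nonneg: "\<And>i. 0 \<le> r i"
    and size: "\<And>i. positive_size (S i) (f i)"
    and \<omega>_pos: "0 < \<omega>"
    and l: "\<And>i. 0 < l i" "\<And>i. l i < 1"
    and doubling: "\<And>i w. 0 < w \<Longrightarrow> w < \<omega> \<Longrightarrow> cdf (S i) w \<le> \<gamma> i * cdf (S i) (l i * w)"
    and cube: "\<And>i. mono_on {0<..<\<omega>} (\<lambda>w. w ^ 3 * f i w)"
    and M_gt_1: "1 < M"
    and ratio: "\<And>i w1 w2. 0 < w1 \<Longrightarrow> w1 < w2 \<Longrightarrow> w2 < \<omega> \<Longrightarrow>
           w2 * (cdf (S i) w2 - cdf (S i) w1) / (LINT w:{w1..w2}|S i. w) \<le> M"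
    and consumption_pos: "0 < mean_consumption p r S (\<omega> / r_max r)"
begin

abbreviation "rM \<equiv> r_max r"
abbreviation "X \<equiv> \<omega> / rM"
abbreviation "U \<equiv> \<lambda>i. positive_size.partial_mean (S i)"

lemma r_le: "r i \<le> rM"
  unfolding r_max_def by (intro Max_ge) auto

lemma mean_consumption_U: "mean_consumption p r S x = (\<Sum>i\<in>UNIV. pmf p i * U i (r i * x))"
  unfolding mean_consumption_def positive_size.partial_mean_def[OF size] ..

lemma rM_pos: "0 < rM"
proof -
  have "0 \<le> rM" using r_nonneg r_le order_trans by blast
  moreover have "rM \<noteq> 0"
  proof
    assume "rM = 0"
    then have "mean_consumption p r S X = 0"
      by (simp add: mean_consumption_U positive_size.partial_mean_0[OF size])
    then show False using consumption_pos by simp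
  qed
  ultimately show ?thesis by simp
qed

lemma X_pos: "0 < X" using \<omega>_pos rM_pos by simp

lemma r_X_le: "r i * X \<le> \<omega>"
  using r_le[of i] rM_pos \<omega>_pos by (simp add: field_simps)

lemma r_less_\<omega>: "0 < x \<Longrightarrow> x < X \<Longrightarrow> r i * x < \<omega>"
proof (cases "r i = 0")
  case False
  assume "0 < x" "x < X"
  then have "r i * x < r i * X" using False r_nonneg[of i] by (intro mult_strict_left_mono) auto
  then show ?thesis using r_X_le[of i] by simp
qed (use \<omega>_pos in simp)

definition slope :: "real \<Rightarrow> real" where
  "slope x = (\<Sum>i\<in>UNIV. pmf p i * ((r i)\<^sup>2 * f i (r i * x)))"

lemma f_nonneg: "0 \<le> f i w"
  using positive_size.f_nonneg[OF size] .

text \<open>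
  Some class contributes to the consumption at \<open>X\<close>. For this class the size density is positive,
  which makes the consumption strictly increasing: the fluid curve can be inverted.
\<close>
lemma density_pos_class:
  "\<exists>i. 0 < pmf p i \<and> 0 < r i \<and> (\<forall>x. 0 < x \<longrightarrow> x < X \<longrightarrow> 0 < f i (r i * x))"
proof -
  have "\<exists>i. 0 < pmf p i * U i (r i * X)"
  proof (rule ccontr)
    assume "\<not> ?thesis"
    then have "mean_consumption p r S X \<le> 0"
      unfolding mean_consumption_U by (intro sum_nonpos) (simp add: linorder_not_less)
    then show False using consumption_pos by simp
  qed
  then obtain i where i: "0 < pmf p i * U i (r i * X)" by blast
  then have p: "0 < pmf p i" and u: "0 < U i (r i * X)"
    using pmf_nonneg[of p i] positive_size.partial_mean_nonneg[OF size[of i], of "r i * X"]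
    by (auto simp: zero_less_mult_iff)
  have "r i \<noteq> 0" using u by (auto simp: positive_size.partial_mean_0[OF size])
  then have r: "0 < r i" using r_nonneg[of i] by simp
  have "0 < f i (r i * x)" if "0 < x" "x < X" for x
    using mult_pos_pos[OF r that(1)] mult_strict_left_mono[OF that(2) r]
    by (intro positive_size.density_pos[OF size l doubling cube u r_X_le])
  with p r show ?thesis by blast
qed

lemma class_deriv:
  assumes "0 < x"
  shows "((\<lambda>x. cdf (S i) (r i * x)) has_real_derivative r i * f i (r i * x)) (at x)"
    and "((\<lambda>x. U i (r i * x)) has_real_derivative x * ((r i)\<^sup>2 * f i (r i * x))) (at x)"
proof -
  interpret positive_size "S i" "f i" by (rule size)
  have "((\<lambda>x. cdf (S i) (r i * x)) has_real_derivative r i * f i (r i * x)) (at x) \<and>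
    ((\<lambda>x. partial_mean (r i * x)) has_real_derivative x * ((r i)\<^sup>2 * f i (r i * x))) (at x)"
  proof (cases "r i = 0")
    case False
    then have rx: "0 < r i * x" using r_nonneg[of i] assms by simp
    have "((\<lambda>x. r i * x) has_real_derivative r i) (at x)"
      using DERIV_cmult_Id by blast
    from DERIV_chain2[OF cdf_deriv[OF rx] this] DERIV_chain2[OF partial_mean_deriv[OF rx] this]
    show ?thesis by (simp add: power2_eq_square mult_ac)
  qed simp
  then show "((\<lambda>x. cdf (S i) (r i * x)) has_real_derivative r i * f i (r i * x)) (at x)"
    "((\<lambda>x. partial_mean (r i * x)) has_real_derivative x * ((r i)\<^sup>2 * f i (r i * x))) (at x)" by auto
qed

sublocale fluid_curve slope "mean_reward p r S" "mean_consumption p r S" X M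
proof
  show "0 < X" by (rule X_pos)
  show "continuous_on {0..} (mean_reward p r S)"
    unfolding mean_reward_def using r_nonneg
    by (intro continuous_on_sum continuous_on_mult continuous_on_const
          continuous_on_compose2[OF positive_size.cdf_cont[OF size]] continuous_on_id) auto
  show "continuous_on {0..} (mean_consumption p r S)"
    unfolding mean_consumption_U using r_nonneg
    by (intro continuous_on_sum continuous_on_mult continuous_on_const
          continuous_on_compose2[OF positive_size.partial_mean_cont[OF size]] continuous_on_id) auto
  show "mean_reward p r S 0 = 0"
    by (simp add: mean_reward_def positive_size.cdf_nonpos[OF size])
  show "mean_consumption p r S 0 = 0"
    by (simp add: mean_consumption_U positive_size.partial_mean_0[OF size])
  show "(mean_reward p r S has_real_derivative slope x) (at x)" if "0 < x" for x
    unfolding mean_reward_def slope_def power2_eq_square mult.assoc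
    by (intro DERIV_sum DERIV_cmult class_deriv that)
  have "((\<lambda>x. \<Sum>i\<in>UNIV. pmf p i * U i (r i * x)) has_real_derivative
      (\<Sum>i\<in>UNIV. pmf p i * (x * ((r i)\<^sup>2 * f i (r i * x))))) (at x)" if "0 < x" for x
    by (intro DERIV_sum DERIV_cmult class_deriv that)
  then show "(mean_consumption p r S has_real_derivative x * slope x) (at x)" if "0 < x" for x
    using that by (simp add: mean_consumption_U[abs_def] slope_def sum_distrib_left mult.left_commute)
  show "0 \<le> slope x" for x
    unfolding slope_def by (intro sum_nonneg mult_nonneg_nonneg f_nonneg) auto
  show "0 < slope x" if x: "0 < x" "x < X" for x
  proof -
    obtain i where "0 < pmf p i" "0 < r i" "0 < f i (r i * x)" using density_pos_class x by blast
    then show ?thesis unfolding slope_def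
      by (intro sum_pos2[of _ i]) (auto intro!: mult_nonneg_nonneg f_nonneg)
  qed
  show "x ^ 3 * slope x \<le> y ^ 3 * slope y" if xy: "0 < x" "x \<le> y" "y < X" for x y
  proof -
    have "x ^ 3 * (pmf p i * ((r i)\<^sup>2 * f i (r i * x))) \<le> y ^ 3 * (pmf p i * ((r i)\<^sup>2 * f i (r i * y)))" for i
    proof (cases "r i = 0")
      case False
      then have r: "0 < r i" using r_nonneg[of i] by simp
      have "(r i * x) ^ 3 * f i (r i * x) \<le> (r i * y) ^ 3 * f i (r i * y)"
        using xy r r_less_\<omega>[of y i] r_less_\<omega>[of x i] by (intro mono_onD[OF cube]) auto
      then have "pmf p i / r i * ((r i * x) ^ 3 * f i (r i * x)) \<le> pmf p i / r i * ((r i * y) ^ 3 * f i (r i * y))"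
        using r by (intro mult_left_mono) auto
      then show ?thesis using r by (simp add: power_mult_distrib power2_eq_square power3_eq_cube mult_ac)
    qed simp
    then show ?thesis unfolding slope_def sum_distrib_left by (intro sum_mono)
  qed
  show "x * mean_reward p r S x \<le> M * mean_consumption p r S x" if x: "0 < x" "x < X" for x
  proof -
    have "x * (pmf p i * (r i * cdf (S i) (r i * x))) \<le> M * (pmf p i * U i (r i * x))" for i
    proof (cases "r i = 0")
      case False
      then have r: "0 < r i" using r_nonneg[of i] by simp
      have "r i * x * cdf (S i) (r i * x) \<le> M * U i (r i * x)"
        using x r r_less_\<omega>[of x i] ratio[of _ "r i * x" i] M_gt_1
        by (intro positive_size.size_times_cdf_le[OF size]) auto
      then have "pmf p i * (r i * x * cdf (S i) (r i * x)) \<le> pmf p i * (M * U i (r i * x))"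
        by (intro mult_left_mono) auto
      then show ?thesis by (simp add: mult_ac)
    qed (simp add: positive_size.partial_mean_0[OF size])
    then show ?thesis unfolding mean_reward_def mean_consumption_U sum_distrib_left by (intro sum_mono)
  qed
qed

lemma mean_reward_le: "mean_reward p r S x \<le> rM"
proof -
  have "mean_reward p r S x \<le> (\<Sum>i\<in>UNIV. pmf p i * (rM * 1))"
    unfolding mean_reward_def
  proof (intro sum_mono mult_left_mono mult_mono)
    fix i
    interpret positive_size "S i" "f i" by (rule size)
    show "cdf (S i) (r i * x) \<le> 1" "0 \<le> cdf (S i) (r i * x)" by (auto simp: cdf_bounded_prob cdf_nonneg)
  qed (use r_le rM_pos in auto)
  also have "\<dots> = rM" by (simp add: sum_distrib_right[symmetric] sum_pmf_eq_1)
  finally show ?thesis .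
qed

end

section \<open>Expectations under the request law\<close>

context request_classes
begin

abbreviation "Q \<equiv> request_law p r S"
abbreviation "g \<equiv> fluid_value"

text \<open>
  The properties that hold for almost every request and carry all bounds along a sample path.
\<close>
definition regular_request :: "request \<Rightarrow> bool" where
  "regular_request q \<longleftrightarrow> 0 \<le> fst q \<and> fst q \<le> rM \<and> 0 < snd q"

definition below :: "real \<Rightarrow> request \<Rightarrow> real" where
  "below x q = of_bool (snd q \<le> fst q * x)"

lemma real_S: "real_distribution (S i)"
  using size by (rule positive_size.axioms(1))

lemma pair_measurable: "(\<lambda>u. (r i, u)) \<in> S i \<rightarrow>\<^sub>M (borel \<Otimes>\<^sub>M borel)"
proof -
  interpret real_distribution "S i" by (rule real_S)
  show ?thesis by measurable
qed

lemma kernel_measurable: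
  "(\<lambda>i. distr (S i) borel (\<lambda>u. (r i, u))) \<in> measure_pmf p \<rightarrow>\<^sub>M subprob_algebra (borel :: request measure)"
proof -
  have "prob_space (distr (S i) borel (\<lambda>u. (r i, u)))" for i
  proof -
    interpret real_distribution "S i" by (rule real_S)
    show ?thesis using pair_measurable[of i] by (intro prob_space_distr) (simp add: borel_prod)
  qed
  then show ?thesis
    by (auto simp: space_subprob_algebra intro: prob_space_imp_subprob_space)
qed

lemma prob_Q: "prob_space Q"
  unfolding request_law_def
proof (rule prob_space.prob_space_bind[OF measure_pmf.prob_space_axioms _ kernel_measurable], rule AE_I2)
  fix i
  interpret real_distribution "S i" by (rule real_S)
  show "prob_space (distr (S i) borel (\<lambda>u. (r i, u)))"
    using pair_measurable[of i] by (intro prob_space_distr) (simp add: borel_prod)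
qed

sublocale Q: prob_space Q by (rule prob_Q)

lemma sets_Q [measurable_cong]: "sets Q = sets (borel \<Otimes>\<^sub>M borel)"
  unfolding request_law_def borel_prod by (rule sets_bind) auto

lemma regular_request_measurable [measurable]: "Measurable.pred (borel \<Otimes>\<^sub>M borel) regular_request"
  unfolding regular_request_def by measurable

lemma AE_regular_request: "AE q in Q. regular_request q"
proof -
  have "AE u in S i. regular_request (r i, u)" for i
    using positive_size.size_pos[OF size[of i]] by eventually_elim (simp add: regular_request_def r_nonneg r_le)
  then show ?thesis
    unfolding request_law_def using pair_measurable regular_request_measurable
    by (subst AE_bind[OF kernel_measurable]) (auto simp: AE_distr_iff borel_prod pred_def)
qed

text \<open>
  The integral against a mixture is the mixture of the integrals for bounded integrands. A bound
  on regular requests suffices, since cutting \<open>h\<close> off elsewhere changes it on a null set only.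
\<close>
lemma integral_request_law:
  fixes h :: "request \<Rightarrow> real"
  assumes [measurable]: "h \<in> borel_measurable (borel \<Otimes>\<^sub>M borel)"
    and bound: "\<And>q. regular_request q \<Longrightarrow> \<bar>h q\<bar> \<le> B"
  shows "integrable Q h" and "(\<integral>q. h q \<partial>Q) = (\<Sum>i\<in>UNIV. pmf p i * (\<integral>u. h (r i, u) \<partial>S i))"
proof -
  show int: "integrable Q h"
    by (rule Q.integrable_const_bound[of _ B]) (use AE_regular_request bound in \<open>auto elim!: eventually_mono\<close>)
  define h' where "h' q = h q * of_bool (regular_request q)" for q
  have [measurable]: "h' \<in> borel_measurable (borel \<Otimes>\<^sub>M borel)" unfolding h'_def by measurable
  have "0 \<le> B"
    using bound[of "(0, 1)"] rM_pos by (simp add: regular_request_def)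
  then have h'_bound: "\<bar>h' q\<bar> \<le> B" for q using bound by (simp add: h'_def)
  have "(\<integral>q. h q \<partial>Q) = (\<integral>q. h' q \<partial>Q)"
    using AE_regular_request by (intro integral_cong_AE) (auto simp: h'_def elim!: eventually_mono)
  also have "\<dots> = (\<integral>i. (\<integral>q. h' q \<partial>distr (S i) borel (\<lambda>u. (r i, u))) \<partial>measure_pmf p)"
    unfolding request_law_def
  proof (rule integral_bind[where B = B and B' = 1, OF _ _ kernel_measurable])
    show "h' \<in> borel_measurable borel" by (simp add: borel_prod[symmetric])
    show "\<bar>h' x\<bar> \<le> B" for x by (rule h'_bound)
    show "finite_measure (measure_pmf p)" by (rule measure_pmf.finite_measure_axioms)
    show "AE i in measure_pmf p. emeasure (distr (S i) borel (\<lambda>u. (r i, u)))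
        (space (distr (S i) borel (\<lambda>u. (r i, u)))) \<le> ennreal 1"
      using measurable_space[OF kernel_measurable]
      by (intro AE_I2) (simp add: Pi_iff space_subprob_algebra subprob_space.emeasure_space_le_1 del: space_distr)
  qed
  also have "\<dots> = (\<Sum>i\<in>UNIV. pmf p i * (\<integral>q. h' q \<partial>distr (S i) borel (\<lambda>u. (r i, u))))"
    by (subst integral_measure_pmf[of UNIV]) auto
  also have "\<dots> = (\<Sum>i\<in>UNIV. pmf p i * (\<integral>u. h (r i, u) \<partial>S i))"
  proof (intro sum.cong refl arg_cong2[where f = "(*)"])
    fix i
    note [measurable] = pair_measurable[of i]
    have "(\<integral>q. h' q \<partial>distr (S i) borel (\<lambda>u. (r i, u))) = (\<integral>u. h' (r i, u) \<partial>S i)"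
      by (subst integral_distr) (auto simp: borel_prod[symmetric])
    also have "\<dots> = (\<integral>u. h (r i, u) \<partial>S i)"
      using positive_size.size_pos[OF size[of i]]
      by (intro integral_cong_AE) (auto simp: h'_def regular_request_def r_nonneg r_le elim!: eventually_mono)
    finally show "(\<integral>q. h' q \<partial>distr (S i) borel (\<lambda>u. (r i, u))) = (\<integral>u. h (r i, u) \<partial>S i)" .
  qed
  finally show "(\<integral>q. h q \<partial>Q) = (\<Sum>i\<in>UNIV. pmf p i * (\<integral>u. h (r i, u) \<partial>S i))" .
qed

lemma below_measurable [measurable]: "below x \<in> borel_measurable (borel \<Otimes>\<^sub>M borel)"
  unfolding below_def by measurable

lemma below_bounds: "0 \<le> below x q" "below x q \<le> 1"
  by (auto simp: below_def)

lemma reward_below: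
  assumes "0 \<le> x"
  shows "integrable Q (\<lambda>q. fst q * below x q)" "(\<integral>q. fst q * below x q \<partial>Q) = mean_reward p r S x"
proof -
  have b: "\<bar>fst q * below x q\<bar> \<le> rM" if "regular_request q" for q
    using that mult_mono[of "fst q" rM "below x q" 1] below_bounds[of x q] by (auto simp: regular_request_def abs_mult)
  have m: "(\<lambda>q. fst q * below x q) \<in> borel_measurable (borel \<Otimes>\<^sub>M borel)" by measurable
  show "integrable Q (\<lambda>q. fst q * below x q)" by (rule integral_request_law(1)[OF m b])
  show "(\<integral>q. fst q * below x q \<partial>Q) = mean_reward p r S x"
    unfolding mean_reward_def
  proof (subst integral_request_law(2)[OF m b], assumption, intro sum.cong refl arg_cong2[where f = "(*)"])
    fix i
    interpret real_distribution "S i" by (rule real_S)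
    have "(\<integral>u. fst (r i, u) * below x (r i, u) \<partial>S i) = (\<integral>u. r i * indicator {..r i * x} u \<partial>S i)"
      by (intro Bochner_Integration.integral_cong) (auto simp: below_def split: split_indicator)
    then show "(\<integral>u. fst (r i, u) * below x (r i, u) \<partial>S i) = r i * cdf (S i) (r i * x)"
      by (simp add: cdf_def)
  qed
qed

lemma size_below:
  assumes "0 \<le> x"
  shows "integrable Q (\<lambda>q. snd q * below x q)" "(\<integral>q. snd q * below x q \<partial>Q) = mean_consumption p r S x"
proof -
  have b: "\<bar>snd q * below x q\<bar> \<le> rM * x" if "regular_request q" for q
    using that mult_right_mono[of "fst q" rM x] assms rM_pos
    by (auto simp: regular_request_def abs_mult below_def)
  have m: "(\<lambda>q. snd q * below x q) \<in> borel_measurable (borel \<Otimes>\<^sub>M borel)" by measurable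
  show "integrable Q (\<lambda>q. snd q * below x q)" by (rule integral_request_law(1)[OF m b])
  show "(\<integral>q. snd q * below x q \<partial>Q) = mean_consumption p r S x"
    unfolding mean_consumption_def
  proof (subst integral_request_law(2)[OF m b], assumption, intro sum.cong refl arg_cong2[where f = "(*)"])
    fix i
    interpret real_distribution "S i" by (rule real_S)
    note [measurable] = pair_measurable[of i]
    show "(\<integral>u. snd (r i, u) * below x (r i, u) \<partial>S i) = (LINT w:{0..r i * x}|S i. w)"
      unfolding set_lebesgue_integral_def using positive_size.size_pos[OF size[of i]]
      by (intro integral_cong_AE) (auto simp: below_def elim!: eventually_mono split: split_indicator)
  qed
qed

lemma fluid_value_measurable [measurable]: "g \<in> borel_measurable borel"
  using fluid_value_cont by (rule borel_measurable_continuous_onI)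

lemma fluid_value_le: "g \<rho> \<le> rM"
  using fluid_value_bounds[of \<rho>] mean_reward_le[of X] by linarith

end

section \<open>The loss of a single period\<close>

context request_classes
begin

text \<open>
  One period of the policy at total capacity \<open>C\<close>, largest capacity \<open>\<beta>\<close> and \<open>k\<close> remaining periods.
  With consumption \<open>Y\<close> the next budget per period is \<open>\<rho> + (\<rho> - Y) / (k - 1)\<close>, where \<open>\<rho> = C / k\<close>,
  and \<open>fluid_value_gap\<close> bounds the loss of continuation value by its linear part, which is
  compensated by the reward, and by \<open>(M - 1) / (\<mu> * \<rho>) * (Y - \<rho>)\<^sup>2 / (k - 1)\<close>. What remains is to
  bound the second moment of \<open>Y - \<rho>\<close>, in two cases.

  If \<open>\<beta>\<close> does not truncate any threshold, the mean of \<open>Y\<close> is \<open>\<rho>\<close> and \<open>Y \<le> rM * \<mu>\<close>, so that the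
  second moment is at most \<open>\<rho> * rM * \<mu>\<close>. If \<open>\<beta>\<close> truncates, then \<open>C \<le> m * \<beta>\<close> makes \<open>\<rho> / \<mu>\<close> as small as
  \<open>m * rM / k\<close>; then \<open>Y \<le> C = k * \<rho>\<close> is enough, and the surplus of the served requests
  over the price of their size can even be given away.
\<close>
lemma one_step:
  fixes k m :: nat
  assumes k: "2 \<le> k" and C: "0 < C" "C \<le> (real k - 1) * mean_consumption p r S X"
    and \<mu>: "0 \<le> \<mu>" "mean_consumption p r S \<mu> = C / real k"
    and \<beta>: "\<beta> \<le> C" "C \<le> real m * \<beta>"
  defines "acc \<equiv> \<lambda>q. snd q \<le> \<beta> \<and> snd q \<le> fst q * \<mu>"
  shows "real k * g (C / real k) - 2 * (M - 1) * real m * rM / real k \<le>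
    (\<integral>q. (if acc q then fst q else 0)
       + (real k - 1) * g ((C - (if acc q then snd q else 0)) / (real k - 1)) \<partial>Q)"
    (is "_ \<le> (\<integral>q. ?h q \<partial>Q)")
proof -
  let ?R = "mean_consumption p r S" and ?G = "mean_reward p r S"
  define \<rho> where "\<rho> = C / real k"
  define K where "K = real k - 1"
  have K: "1 \<le> K" "real k = K + 1" using k by (auto simp: K_def)
  have \<rho>: "0 < \<rho>" "C = (K + 1) * \<rho>" "?R \<mu> = \<rho>" using C K \<mu> by (auto simp: \<rho>_def)
  have "\<rho> < C / K" using C K by (simp add: \<rho>_def field_simps)
  also have "\<dots> \<le> ?R X" using C K by (simp add: field_simps)
  finally have \<mu>X: "\<mu> < X" using R_less_iff[OF \<mu>(1)] \<rho>(3) by simp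
  have "\<mu> \<noteq> 0" using \<rho> R_0 by auto
  then have \<mu>0: "0 < \<mu>" using \<mu>(1) by simp
  have g\<rho>: "g \<rho> = ?G \<mu>" using fluid_value_R[of \<mu>] \<mu>0 \<mu>X \<rho>(3) by simp
  define \<kappa> where "\<kappa> = (M - 1) / (\<mu> * \<rho>)"
  have \<kappa>: "0 \<le> \<kappa>" using M_gt_1 \<mu>0 \<rho> by (simp add: \<kappa>_def)
  have m: "1 \<le> real m" using C \<beta> by (cases m) auto
  have \<beta>0: "0 < \<beta>" using C \<beta> m by (metis less_le_trans not_less mult_nonneg_nonpos of_nat_0_le_iff)
  have rM\<mu>: "fst q * \<mu> \<le> rM * \<mu>" if "regular_request q" for q
    using that \<mu>0 by (simp add: regular_request_def)

  have acc_meas [measurable]: "Measurable.pred (borel \<Otimes>\<^sub>M borel) acc"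
    unfolding acc_def by measurable
  have h_meas: "?h \<in> borel_measurable (borel \<Otimes>\<^sub>M borel)" by measurable
  have h_bound: "\<bar>?h q\<bar> \<le> rM + K * rM" if "regular_request q" for q
  proof -
    have "\<bar>K * g s\<bar> \<le> K * rM" for s
      using K fluid_value_le[of s] fluid_value_bounds[of s] by (simp add: abs_mult)
    then show ?thesis
      using that rM_pos unfolding regular_request_def K_def[symmetric]
      by (intro order_trans[OF abs_triangle_ineq] add_mono) auto
  qed
  have h_int: "integrable Q ?h" by (rule integral_request_law(1)[OF h_meas h_bound])
  \<comment> \<open>In both cases the integrand is bounded below by an affine function of the reward and of the
    size of a request that passes the threshold \<open>r * \<mu>\<close>; their means are \<open>G \<mu>\<close> and \<open>\<rho>\<close>.\<close>
  have expectation_ge: "\<alpha>0 + \<alpha>1 * ?G \<mu> + \<alpha>2 * \<rho> \<le> (\<integral>q. ?h q \<partial>Q)"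
    if le: "\<And>q. regular_request q \<Longrightarrow> \<alpha>0 + \<alpha>1 * (fst q * below \<mu> q) + \<alpha>2 * (snd q * below \<mu> q) \<le> ?h q"
    for \<alpha>0 \<alpha>1 \<alpha>2
  proof -
    note int = reward_below[OF \<mu>(1)] size_below[OF \<mu>(1)]
    have "\<alpha>0 + \<alpha>1 * ?G \<mu> + \<alpha>2 * \<rho> =
        (\<integral>q. \<alpha>0 + \<alpha>1 * (fst q * below \<mu> q) + \<alpha>2 * (snd q * below \<mu> q) \<partial>Q)"
      using int \<rho>(3) by (simp add: Q.prob_space)
    also have "\<dots> \<le> (\<integral>q. ?h q \<partial>Q)"
    proof (rule integral_mono_AE)
      show "AE q in Q. \<alpha>0 + \<alpha>1 * (fst q * below \<mu> q) + \<alpha>2 * (snd q * below \<mu> q) \<le> ?h q"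
        using AE_regular_request by (rule eventually_mono) (rule le)
    qed (use int h_int in auto)
    finally show ?thesis .
  qed

  have pointwise: "(if acc q then fst q else 0) + K * ?G \<mu> - (y - \<rho>) / \<mu> - \<kappa> / K * (y - \<rho>)\<^sup>2 \<le> ?h q"
    if q: "regular_request q" and y: "y = (if acc q then snd q else 0)" for q y
  proof -
    have "0 \<le> y" "y \<le> \<beta>" using q y \<beta>0 by (auto simp: acc_def regular_request_def)
    define s where "s = (C - y) / K"
    have s: "0 \<le> s" "s \<le> ?R X" using \<open>0 \<le> y\<close> \<open>y \<le> \<beta>\<close> \<beta> C K by (auto simp: s_def field_simps)
    have "\<rho> - s = (y - \<rho>) / K" using K \<rho>(2) by (simp add: s_def field_simps)
    then have "?G \<mu> - g s - (y - \<rho>) / K / \<mu> \<le> \<kappa> * ((y - \<rho>) / K)\<^sup>2"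
      using fluid_value_gap[OF \<mu>0 \<mu>X s] \<rho>(3) by (simp add: \<kappa>_def)
    then have "K * (?G \<mu> - g s - (y - \<rho>) / K / \<mu>) \<le> K * (\<kappa> * ((y - \<rho>) / K)\<^sup>2)"
      using K by (intro mult_left_mono) auto
    moreover have "K * (\<kappa> * ((y - \<rho>) / K)\<^sup>2) = \<kappa> / K * (y - \<rho>)\<^sup>2" using K by (simp add: power2_eq_square)
    moreover have e: "K * (?G \<mu> - g s - z / K / \<mu>) = K * ?G \<mu> - K * g s - z / \<mu>" for z
      using K \<mu>0 by (simp add: field_simps)
    ultimately show ?thesis
      using e[of "y - \<rho>"] unfolding K_def[symmetric] y[symmetric] s_def[symmetric] by linarith
  qed

  show ?thesis
  proof (cases "rM * \<mu> \<le> \<beta>")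
    case True
    have "(K * ?G \<mu> + \<rho> / \<mu> - \<kappa> / K * \<rho>\<^sup>2) + 1 * ?G \<mu> + (- 1 / \<mu> - \<kappa> / K * (rM * \<mu> - 2 * \<rho>)) * \<rho>
        \<le> (\<integral>q. ?h q \<partial>Q)"
    proof (rule expectation_ge)
      fix q assume q: "regular_request q"
      define y where "y = snd q * below \<mu> q"
      have acc: "acc q \<longleftrightarrow> snd q \<le> fst q * \<mu>" using rM\<mu>[OF q] True by (auto simp: acc_def)
      then have y: "y = (if acc q then snd q else 0)" "fst q * below \<mu> q = (if acc q then fst q else 0)"
        by (auto simp: y_def below_def)
      have y_bd: "0 \<le> y" "y \<le> rM * \<mu>" using order_trans[OF _ rM\<mu>[OF q], of "snd q"] q acc \<mu>0 rM_pos
        by (auto simp: y regular_request_def)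
      have "(y - \<rho>)\<^sup>2 \<le> y * (rM * \<mu> - 2 * \<rho>) + \<rho>\<^sup>2"
        using mult_left_mono[OF y_bd(2,1)] by (simp add: power2_eq_square algebra_simps)
      then have "\<kappa> / K * (y - \<rho>)\<^sup>2 \<le> \<kappa> / K * (y * (rM * \<mu> - 2 * \<rho>) + \<rho>\<^sup>2)"
        using \<kappa> K by (intro mult_left_mono) auto
      with pointwise[OF q y(1)] show "K * ?G \<mu> + \<rho> / \<mu> - \<kappa> / K * \<rho>\<^sup>2 + 1 * (fst q * below \<mu> q)
          + (- 1 / \<mu> - \<kappa> / K * (rM * \<mu> - 2 * \<rho>)) * (snd q * below \<mu> q) \<le> ?h q"
        unfolding y(2) y_def[symmetric] by (simp add: algebra_simps diff_divide_distrib)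
    qed
    moreover have "(K * ?G \<mu> + \<rho> / \<mu> - \<kappa> / K * \<rho>\<^sup>2) + 1 * ?G \<mu> + (- 1 / \<mu> - \<kappa> / K * (rM * \<mu> - 2 * \<rho>)) * \<rho>
        = real k * ?G \<mu> - (M - 1) * (rM - \<rho> / \<mu>) / K"
      using \<mu>0 \<rho> K by (simp add: \<kappa>_def field_simps power2_eq_square)
    moreover have "(M - 1) * (rM - \<rho> / \<mu>) / K \<le> 2 * (M - 1) * real m * rM / real k"
    proof -
      have "rM - \<rho> / \<mu> \<le> 1 * rM" using \<rho> \<mu>0 by simp
      also have "\<dots> \<le> real m * rM" using m rM_pos by (intro mult_right_mono) auto
      finally have "(M - 1) * (rM - \<rho> / \<mu>) / K \<le> (M - 1) * (real m * rM) / K"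
        using M_gt_1 K by (intro divide_right_mono mult_left_mono) auto
      also have "\<dots> \<le> (M - 1) * (real m * rM) / (real k / 2)"
        using M_gt_1 K rM_pos by (intro frac_le) auto
      finally have "(M - 1) * (rM - \<rho> / \<mu>) / K \<le> (M - 1) * (real m * rM) / (real k / 2)" .
      then show ?thesis by (simp add: mult_ac)
    qed
    ultimately show ?thesis unfolding \<rho>_def[symmetric] g\<rho> by linarith
  next
    case False
    have "(K * ?G \<mu> + \<rho> / \<mu> - \<kappa> / K * \<rho>\<^sup>2) + 0 * ?G \<mu> + (- \<kappa> / K * ((K - 1) * \<rho>)) * \<rho> \<le> (\<integral>q. ?h q \<partial>Q)"
    proof (rule expectation_ge)
      fix q assume q: "regular_request q"
      define y where "y = (if acc q then snd q else 0)"
      have y_bd: "0 \<le> y" "y \<le> C" "y \<le> snd q * below \<mu> q"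
        using q \<beta> C by (auto simp: y_def acc_def regular_request_def below_def)
      have "y / \<mu> \<le> (if acc q then fst q else 0)"
        using \<mu>0 by (auto simp: y_def acc_def field_simps)
      moreover have "(y - \<rho>)\<^sup>2 \<le> y * ((K - 1) * \<rho>) + \<rho>\<^sup>2"
        using mult_left_mono[OF y_bd(2,1)] unfolding \<rho>(2) by (simp add: power2_eq_square algebra_simps)
      moreover have "y * ((K - 1) * \<rho>) \<le> snd q * below \<mu> q * ((K - 1) * \<rho>)"
        using y_bd K \<rho> by (intro mult_right_mono) auto
      ultimately have "y / \<mu> \<le> (if acc q then fst q else 0)"
        "\<kappa> / K * (y - \<rho>)\<^sup>2 \<le> \<kappa> / K * (snd q * below \<mu> q * ((K - 1) * \<rho>) + \<rho>\<^sup>2)"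
        using \<kappa> K by (auto intro!: mult_left_mono divide_right_mono)
      moreover have e: "(- \<kappa> / K * ((K - 1) * \<rho>)) * z = \<kappa> / K * \<rho>\<^sup>2 - \<kappa> / K * (z * ((K - 1) * \<rho>) + \<rho>\<^sup>2)" for z
        by (simp add: distrib_left)
      ultimately show "K * ?G \<mu> + \<rho> / \<mu> - \<kappa> / K * \<rho>\<^sup>2 + 0 * (fst q * below \<mu> q)
          + (- \<kappa> / K * ((K - 1) * \<rho>)) * (snd q * below \<mu> q) \<le> ?h q"
        using pointwise[OF q y_def] e[of "snd q * below \<mu> q"] diff_divide_distrib[of y \<rho> \<mu>] by linarith
    qed
    moreover have "(K * ?G \<mu> + \<rho> / \<mu> - \<kappa> / K * \<rho>\<^sup>2) + 0 * ?G \<mu> + (- \<kappa> / K * ((K - 1) * \<rho>)) * \<rho>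
        = K * ?G \<mu> + \<rho> / \<mu> - (M - 1) * (\<rho> / \<mu>)"
      using \<mu>0 \<rho> K by (simp add: \<kappa>_def field_simps power2_eq_square)
    moreover have "?G \<mu> \<le> M * (\<rho> / \<mu>)"
      using reward_per_use[OF \<mu>0 \<mu>X] \<mu>0 \<rho>(3) by (simp add: field_simps)
    moreover have "2 * ((M - 1) * (\<rho> / \<mu>)) \<le> 2 * (M - 1) * real m * rM / real k"
    proof -
      have "real k * \<rho> \<le> real m * (rM * \<mu>)"
        using \<beta>(2) mult_left_mono[of \<beta> "rM * \<mu>" "real m"] False unfolding \<rho>(2) K(2) by linarith
      then have "\<rho> / \<mu> \<le> real m * rM / real k" using \<mu>0 K by (simp add: field_simps)
      then have "2 * (M - 1) * (\<rho> / \<mu>) \<le> 2 * (M - 1) * (real m * rM / real k)"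
        using M_gt_1 by (intro mult_left_mono) auto
      then show ?thesis by (simp only: mult.assoc times_divide_eq_right)
    qed
    moreover have "real k * ?G \<mu> = K * ?G \<mu> + ?G \<mu>" "M * (\<rho> / \<mu>) = \<rho> / \<mu> + (M - 1) * (\<rho> / \<mu>)"
      using K by (simp_all add: left_diff_distrib distrib_right diff_divide_distrib)
    ultimately show ?thesis unfolding \<rho>_def[symmetric] g\<rho> by linarith
  qed
qed

end

section \<open>The capacity process and the telescoped losses\<close>

locale atp2_run = request_classes +
  fixes m T :: nat and c :: "nat \<Rightarrow> real"
    and \<mu> :: "nat \<Rightarrow> (nat \<Rightarrow> real) \<Rightarrow> ereal" and J :: "nat \<Rightarrow> (nat \<Rightarrow> real) \<Rightarrow> nat"
  assumes m_pos: "1 \<le> m" and T_pos: "1 \<le> T" and c_nonneg: "\<And>j. j < m \<Longrightarrow> 0 \<le> c j"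
    and multiplier: "ATP2_multiplier p r S m T \<mu>" and largest: "largest_resource m T J"
begin

abbreviation "P \<equiv> \<Pi>\<^sub>M t\<in>{1..T}. Q"
abbreviation "cap \<equiv> ATP2_capacity \<mu> J c"
abbreviation stock :: "(nat \<Rightarrow> real) \<Rightarrow> real" where "stock b \<equiv> \<Sum>j<m. b j"
abbreviation "accepts \<equiv> ATP2_accepts \<mu> J"

definition step :: "nat \<Rightarrow> (nat \<Rightarrow> real) \<Rightarrow> request \<Rightarrow> nat \<Rightarrow> real" where
  "step t b q = (if accepts t b q then b(J t b := b (J t b) - snd q) else b)"

definition gain :: "nat \<Rightarrow> (nat \<Rightarrow> real) \<Rightarrow> request \<Rightarrow> real" where
  "gain t b q = (if accepts t b q then fst q else 0)"

lemma cap_Suc: "cap I (Suc t) = step (Suc t) (cap I t) (I (Suc t))"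
  by (simp add: step_def Let_def)

declare ATP2_capacity.simps(2) [simp del]

lemma cap_cong: "(\<And>s. 1 \<le> s \<Longrightarrow> s \<le> t \<Longrightarrow> I s = I' s) \<Longrightarrow> cap I t = cap I' t"
  by (induction t) (auto simp: cap_Suc)

lemma J_less: "1 \<le> t \<Longrightarrow> t \<le> T \<Longrightarrow> J t b < m"
  and J_Max: "1 \<le> t \<Longrightarrow> t \<le> T \<Longrightarrow> b (J t b) = Max (b ` {..<m})"
  using largest by (auto simp: largest_resource_def)

lemma allocation_value_ATP2:
  "allocation_value m T I (ATP2 \<mu> J c I) = (\<Sum>t<T. gain (Suc t) (cap I t) (I (Suc t)))"
proof -
  have "(\<Sum>j<m. fst (I t) * ATP2 \<mu> J c I t j) = gain t (cap I (t - 1)) (I t)" if "t \<in> {1..T}" for t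
  proof -
    have "(\<Sum>j<m. fst (I t) * ATP2 \<mu> J c I t j)
        = (\<Sum>j<m. if j = J t (cap I (t - 1)) then gain t (cap I (t - 1)) (I t) else 0)"
      by (intro sum.cong) (auto simp: ATP2_def Let_def gain_def)
    then show ?thesis using J_less[of t] that by simp
  qed
  then show ?thesis
    unfolding allocation_value_def by (simp add: sum.atLeast1_atMost_eq)
qed

lemma accepts_measurable:
  assumes t: "t \<in> {1..T}" and [measurable]: "b \<in> N \<rightarrow>\<^sub>M borel" "q \<in> N \<rightarrow>\<^sub>M borel \<Otimes>\<^sub>M borel"
  shows "Measurable.pred N (\<lambda>x. accepts t (b x) (q x))"
    and "(\<lambda>x. J t (b x)) \<in> N \<rightarrow>\<^sub>M count_space UNIV"
proof -
  have J [measurable]: "J t \<in> borel \<rightarrow>\<^sub>M count_space UNIV" and \<mu> [measurable]: "\<mu> t \<in> borel_measurable borel"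
    using t largest multiplier by (auto simp: largest_resource_def ATP2_multiplier_def)
  show J': "(\<lambda>x. J t (b x)) \<in> N \<rightarrow>\<^sub>M count_space UNIV" by measurable
  have [measurable]: "(\<lambda>x. b x (J t (b x))) \<in> borel_measurable N"
    by (rule measurable_compose_countable[OF _ J', of "\<lambda>i x. b x i"])
      (rule measurable_compose[OF assms(2) measurable_product_coordinates])
  have [measurable]: "(\<lambda>x. \<mu> t (b x)) \<in> borel_measurable N"
    by (rule measurable_compose[OF assms(2) \<mu>])
  show "Measurable.pred N (\<lambda>x. accepts t (b x) (q x))"
    unfolding ATP2_accepts_def by measurable
qed

lemma step_measurable:
  assumes t: "t \<in> {1..T}" and b: "b \<in> N \<rightarrow>\<^sub>M borel" and q: "q \<in> N \<rightarrow>\<^sub>M borel \<Otimes>\<^sub>M borel"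
  shows "(\<lambda>x. step t (b x) (q x)) \<in> N \<rightarrow>\<^sub>M borel"
proof (rule measurable_coordinatewise_then_product)
  fix j
  note [measurable] = accepts_measurable[OF t b q] q measurable_compose[OF b measurable_product_coordinates[of j]]
  have "(\<lambda>x. step t (b x) (q x) j) =
      (\<lambda>x. if accepts t (b x) (q x) \<and> J t (b x) = j then b x j - snd (q x) else b x j)"
    by (auto simp: step_def)
  then show "(\<lambda>x. step t (b x) (q x) j) \<in> borel_measurable N" by simp
qed

lemma gain_measurable:
  assumes t: "t \<in> {1..T}" and b: "b \<in> N \<rightarrow>\<^sub>M borel" and q: "q \<in> N \<rightarrow>\<^sub>M borel \<Otimes>\<^sub>M borel"
  shows "(\<lambda>x. gain t (b x) (q x)) \<in> borel_measurable N"
proof -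
  note [measurable] = accepts_measurable[OF t b q] q
  show ?thesis unfolding gain_def by measurable
qed

lemma request_measurable: "t \<in> {1..T} \<Longrightarrow> (\<lambda>I. I t) \<in> P \<rightarrow>\<^sub>M borel \<Otimes>\<^sub>M borel"
  using measurable_component_singleton[of t "{1..T}" "\<lambda>_. Q"] measurable_cong_sets[OF refl sets_Q] by blast

lemma cap_measurable: "t \<le> T \<Longrightarrow> (\<lambda>I. cap I t) \<in> P \<rightarrow>\<^sub>M borel"
proof (induction t)
  case (Suc t)
  then show ?case unfolding cap_Suc by (intro step_measurable request_measurable) auto
qed simp

sublocale P: prob_space P
  by (rule prob_space_PiM) (rule prob_Q)

text \<open>
  The simplifier turns \<open>{1..T}\<close> into \<open>{Suc 0..T}\<close>; these copies match the result.
\<close>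
lemmas P_constant [simp] = P.prob_space[unfolded One_nat_def] P.integrable_const[unfolded One_nat_def]

lemma AE_regular_requests: "AE I in P. \<forall>t\<in>{1..T}. regular_request (I t)"
  by (intro AE_finite_allI) (auto intro: AE_PiM_component prob_Q AE_regular_request)

text \<open>
  The invariant of the capacity process on regular requests.
\<close>
definition admissible :: "(nat \<Rightarrow> real) \<Rightarrow> bool" where
  "admissible b \<longleftrightarrow> (\<forall>j<m. 0 \<le> b j) \<and> stock b \<le> stock c"

lemma stock_step:
  assumes "1 \<le> t" "t \<le> T"
  shows "stock (step t b q) = stock b - (if accepts t b q then snd q else 0)"
proof -
  have "stock (b(J t b := b (J t b) - snd q)) = (b (J t b) - snd q) + (\<Sum>j\<in>{..<m} - {J t b}. b j)"
    using J_less[OF assms] by (subst sum.remove[of _ "J t b"]) auto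
  also have "\<dots> = stock b - snd q"
    using J_less[OF assms] by (subst (2) sum.remove[of _ "J t b"]) auto
  finally show ?thesis by (simp add: step_def)
qed

lemma admissible_step:
  assumes "1 \<le> t" "t \<le> T" "admissible b" "regular_request q"
  shows "admissible (step t b q)"
  using assms stock_step[of t b q]
  by (auto simp: admissible_def regular_request_def step_def ATP2_accepts_def)

lemma admissible_cap:
  assumes "\<forall>t\<in>{1..T}. regular_request (I t)" "t \<le> T"
  shows "admissible (cap I t)"
  using assms(2)
proof (induction t)
  case 0
  then show ?case using c_nonneg by (simp add: admissible_def)
next
  case (Suc t)
  then show ?case unfolding cap_Suc using assms(1) by (intro admissible_step) auto
qed

lemma stock_measurable: "b \<in> N \<rightarrow>\<^sub>M borel \<Longrightarrow> (\<lambda>x. stock (b x)) \<in> borel_measurable N"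
  by (rule borel_measurable_sum) (rule measurable_compose[OF _ measurable_product_coordinates])

text \<open>
  The capacities at the start of a period are a function of the earlier requests only, so by
  Fubini the request of the period can be integrated out with the capacities held fixed.
\<close>
lemma fresh_request:
  fixes \<phi> :: "(nat \<Rightarrow> real) \<Rightarrow> request \<Rightarrow> real"
  assumes t: "t < T" and \<phi>: "(\<lambda>(b, q). \<phi> b q) \<in> borel_measurable (borel \<Otimes>\<^sub>M (borel \<Otimes>\<^sub>M borel))"
    and bound: "\<And>b q. admissible b \<Longrightarrow> regular_request q \<Longrightarrow> \<bar>\<phi> b q\<bar> \<le> B"
  shows "integrable P (\<lambda>I. \<phi> (cap I t) (I (Suc t)))" "integrable P (\<lambda>I. \<integral>q. \<phi> (cap I t) q \<partial>Q)"
    "(\<integral>I. \<phi> (cap I t) (I (Suc t)) \<partial>P) = (\<integral>I. \<integral>q. \<phi> (cap I t) q \<partial>Q \<partial>P)"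
proof -
  have cap [measurable]: "(\<lambda>I. cap I t) \<in> P \<rightarrow>\<^sub>M borel" using t by (intro cap_measurable) auto
  have req [measurable]: "(\<lambda>I. I (Suc t)) \<in> P \<rightarrow>\<^sub>M borel \<Otimes>\<^sub>M borel" using t by (intro request_measurable) auto
  have m1: "(\<lambda>I. \<phi> (cap I t) (I (Suc t))) \<in> borel_measurable P"
    using measurable_compose[OF measurable_Pair[OF cap req] \<phi>] by simp
  have "(\<lambda>(I, q). \<phi> (cap I t) q) \<in> borel_measurable (P \<Otimes>\<^sub>M (borel \<Otimes>\<^sub>M borel))"
    using measurable_compose[OF measurable_Pair[OF measurable_compose[OF measurable_fst cap] measurable_snd] \<phi>]
    by (simp add: split_beta')
  then have "(\<lambda>(I, q). \<phi> (cap I t) q) \<in> borel_measurable (P \<Otimes>\<^sub>M Q)"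
    by (simp cong: measurable_cong_sets add: sets_pair_measure_cong[OF refl sets_Q])
  then have m2: "(\<lambda>I. \<integral>q. \<phi> (cap I t) q \<partial>Q) \<in> borel_measurable P"
    by (rule Q.borel_measurable_lebesgue_integral)
  show i1: "integrable P (\<lambda>I. \<phi> (cap I t) (I (Suc t)))"
  proof (rule P.integrable_const_bound[OF _ m1])
    show "AE I in P. norm (\<phi> (cap I t) (I (Suc t))) \<le> B"
      using AE_regular_requests by eventually_elim (use t in \<open>auto intro!: bound admissible_cap\<close>)
  qed
  show i2: "integrable P (\<lambda>I. \<integral>q. \<phi> (cap I t) q \<partial>Q)"
  proof (rule P.integrable_const_bound[OF _ m2])
    have mean_bound: "\<bar>\<integral>q. \<phi> b q \<partial>Q\<bar> \<le> B" if b: "admissible b" for b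
    proof -
      have "\<bar>\<integral>q. \<phi> b q \<partial>Q\<bar> \<le> (\<integral>q. \<bar>\<phi> b q\<bar> \<partial>Q)" by (rule integral_abs_bound)
      also have "\<dots> \<le> (\<integral>q. B \<partial>Q)"
      proof (rule integral_mono_AE')
        show "AE q in Q. \<bar>\<phi> b q\<bar> \<le> B"
          using AE_regular_request by (rule eventually_mono) (rule bound[OF b])
        then show "AE q in Q. 0 \<le> B" by (rule eventually_mono) simp
      qed simp
      finally show ?thesis by (simp add: Q.prob_space)
    qed
    show "AE I in P. norm (\<integral>q. \<phi> (cap I t) q \<partial>Q) \<le> B"
      using AE_regular_requests
    proof eventually_elim
      case (elim I)
      then show ?case using t by (simp add: mean_bound admissible_cap)
    qed
  qed
  interpret product_sigma_finite "\<lambda>_ :: nat. Q"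
    by (simp add: product_sigma_finite_def Q.sigma_finite_measure_axioms)
  define A where "A = {1..T} - {Suc t}"
  have ins: "{1..T} = insert (Suc t) A" "finite A" "Suc t \<notin> A" using t by (auto simp: A_def)
  have cap_upd: "cap (I(Suc t := y)) t = cap I t" for I y by (rule cap_cong) auto
  have "(\<integral>I. \<phi> (cap I t) (I (Suc t)) \<partial>P) = (\<integral>I. \<integral>q. \<phi> (cap I t) q \<partial>Q \<partial>(\<Pi>\<^sub>M t\<in>A. Q))"
    using product_integral_insert[OF ins(2,3) i1[unfolded ins(1)]] by (simp add: ins(1)[unfolded One_nat_def] cap_upd)
  also have "\<dots> = (\<integral>I. \<integral>q. \<phi> (cap I t) q \<partial>Q \<partial>P)"
    using product_integral_insert[OF ins(2,3) i2[unfolded ins(1)]] by (simp add: ins(1)[unfolded One_nat_def] cap_upd Q.prob_space)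
  finally show "(\<integral>I. \<phi> (cap I t) (I (Suc t)) \<partial>P) = (\<integral>I. \<integral>q. \<phi> (cap I t) q \<partial>Q \<partial>P)" .
qed

text \<open>
  The potential of the regret analysis: the fluid value of \<open>k\<close> remaining periods.
\<close>
definition fluid :: "nat \<Rightarrow> (nat \<Rightarrow> real) \<Rightarrow> real" where
  "fluid k b = real k * g (stock b / real k)"

abbreviation "step_loss \<equiv> 2 * (M - 1) * real m * rM"

definition N :: nat where "N = nat (K_hat p r S \<omega> m c)"

lemma stock_c_le: "stock c \<le> real N * mean_consumption p r S X"
proof -
  have "stock c / mean_consumption p r S X \<le> real_of_int (K_hat p r S \<omega> m c)"
    unfolding K_hat_def by (rule le_of_int_ceiling)
  also have "\<dots> \<le> real N" unfolding N_def by simp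
  finally show ?thesis using consumption_pos by (simp add: field_simps)
qed

lemma fluid_bounds: "0 \<le> fluid k b" "fluid k b \<le> real k * rM"
  unfolding fluid_def using fluid_value_bounds fluid_value_le by (auto intro!: mult_left_mono)

lemma fluid_measurable: "b \<in> L \<rightarrow>\<^sub>M borel \<Longrightarrow> (\<lambda>x. fluid k (b x)) \<in> borel_measurable L"
  unfolding fluid_def
  by (intro borel_measurable_times borel_measurable_const
      measurable_compose[OF borel_measurable_divide[OF stock_measurable borel_measurable_const] fluid_value_measurable])

lemma gain_bounds: "regular_request q \<Longrightarrow> 0 \<le> gain t b q" "regular_request q \<Longrightarrow> gain t b q \<le> rM"
  using rM_pos by (auto simp: gain_def regular_request_def)

text \<open>
  With more than \<open>N\<close> periods left, the budget per period is at most the consumption at \<open>X\<close>, even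
  if nothing is consumed in the current period; so the multiplier equation is solvable on the part
  of the fluid curve where the regularity assumption applies, and \<open>one_step\<close> can be used.
\<close>
lemma step_bound:
  assumes t: "t < T" and k: "k = T - t" "N < k" and b: "admissible b"
  shows "fluid k b - step_loss / real k \<le> (\<integral>q. gain (Suc t) b q + fluid (k - 1) (step (Suc t) b q) \<partial>Q)"
proof (cases "stock b = 0")
  case True
  have "fluid_value 0 = 0" using fluid_value_R[of 0] R_0 G_0 X_pos by simp
  then have "fluid k b = 0" by (simp add: fluid_def True)
  moreover have "0 \<le> step_loss / real k" using M_gt_1 rM_pos by simp
  moreover have "0 \<le> (\<integral>q. gain (Suc t) b q + fluid (k - 1) (step (Suc t) b q) \<partial>Q)"
    using AE_regular_request by (intro integral_nonneg_AE) (auto elim!: eventually_mono simp: gain_bounds fluid_bounds)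
  ultimately show ?thesis by linarith
next
  case False
  have b0: "\<And>j. j < m \<Longrightarrow> 0 \<le> b j" and bc: "stock b \<le> stock c" using b by (auto simp: admissible_def)
  have C: "0 < stock b" using False sum_nonneg[of "{..<m}" b] b0 by force
  \<comment> \<open>A positive capacity forces \<open>N > 0\<close>, hence at least two remaining periods.\<close>
  have "N \<noteq> 0" using stock_c_le bc C by (cases N) auto
  then have k2: "2 \<le> k" using k by simp
  have k1: "real (k - 1) = real k - 1" using k2 by simp
  have "stock b \<le> real N * mean_consumption p r S X" using bc stock_c_le by linarith
  also have "\<dots> \<le> (real k - 1) * mean_consumption p r S X"
    using k(2) consumption_pos by (intro mult_right_mono) auto
  finally have CX: "stock b \<le> (real k - 1) * mean_consumption p r S X" .
  have tT: "1 \<le> Suc t" "Suc t \<le> T" "T - Suc t + 1 = k" using t k by auto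
  define \<beta> where "\<beta> = b (J (Suc t) b)"
  have \<beta>_Max: "\<beta> = Max (b ` {..<m})" unfolding \<beta>_def by (rule J_Max[OF tT(1,2)])
  have \<beta>1: "\<beta> \<le> stock b"
    unfolding \<beta>_def using b0 J_less[OF tT(1,2)] by (intro member_le_sum) auto
  have \<beta>2: "stock b \<le> real m * \<beta>"
    using sum_bounded_above[of "{..<m}" b \<beta>] unfolding \<beta>_Max by simp
  define sol where "sol = {x. 0 \<le> x \<and> mean_consumption p r S x = stock b / real k}"
  have "(real k - 1) * mean_consumption p r S X \<le> real k * mean_consumption p r S X"
    using consumption_pos by (intro mult_right_mono) auto
  then have "stock b / real k \<le> mean_consumption p r S X" using CX k2 by (simp add: field_simps)
  then obtain x0 where "0 \<le> x0" "x0 \<le> X" "mean_consumption p r S x0 = stock b / real k"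
    using obtain_multiplier[of "stock b / real k"] C by auto
  then have "sol \<noteq> {}" by (auto simp: sol_def)
  moreover have "if sol = {} then \<mu> (Suc t) b = \<infinity> else \<mu> (Suc t) b \<in> ereal ` sol"
  proof -
    have "Suc t \<in> {1..T}" using t by simp
    from bspec[OF multiplier[unfolded ATP2_multiplier_def] this, THEN conjunct2, rule_format, of b, OF b0]
    show ?thesis unfolding Let_def tT(3) sol_def by simp
  qed
  ultimately have "\<mu> (Suc t) b \<in> ereal ` sol" by simp
  then obtain x where x: "0 \<le> x" "mean_consumption p r S x = stock b / real k" "\<mu> (Suc t) b = ereal x"
    unfolding sol_def by blast
  have acc: "accepts (Suc t) b q \<longleftrightarrow> snd q \<le> \<beta> \<and> snd q \<le> fst q * x" for q
    by (simp add: ATP2_accepts_def x(3) \<beta>_def)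
  have "real k * g (stock b / real k) - step_loss / real k \<le>
      (\<integral>q. (if snd q \<le> \<beta> \<and> snd q \<le> fst q * x then fst q else 0)
       + (real k - 1) * g ((stock b - (if snd q \<le> \<beta> \<and> snd q \<le> fst q * x then snd q else 0)) / (real k - 1)) \<partial>Q)"
    by (rule one_step[OF k2 C CX x(1,2) \<beta>1 \<beta>2])
  then show ?thesis
    unfolding fluid_def gain_def stock_step[OF tT(1,2)] acc k1 .
qed

definition expected_gain :: "nat \<Rightarrow> real" where
  "expected_gain t = (\<integral>I. gain (Suc t) (cap I t) (I (Suc t)) \<partial>P)"

lemma gain_integrable: "t < T \<Longrightarrow> integrable P (\<lambda>I. gain (Suc t) (cap I t) (I (Suc t)))"
proof (rule fresh_request(1)[where B = rM])
  show "(\<lambda>(b, q). gain (Suc t) b q) \<in> borel_measurable (borel \<Otimes>\<^sub>M borel \<Otimes>\<^sub>M borel)" if "t < T"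
    unfolding split_beta' using that by (intro gain_measurable) auto
qed (use gain_bounds in \<open>auto simp: abs_le_iff intro: order_trans[of _ 0]\<close>)

lemma expected_gain_nonneg: "t < T \<Longrightarrow> 0 \<le> expected_gain t"
  unfolding expected_gain_def using AE_regular_requests
  by (intro integral_nonneg_AE) (auto elim!: eventually_mono intro!: gain_bounds)

lemma fluid_integrable: "t \<le> T \<Longrightarrow> integrable P (\<lambda>I. fluid k (cap I t))"
  using fluid_bounds[of k] rM_pos
  by (intro P.integrable_const_bound[of _ "real k * rM"] fluid_measurable cap_measurable) auto

lemma expected_fluid_step:
  assumes t: "t < T" and N: "N < T - t"
  shows "(\<integral>I. fluid (T - t) (cap I t) \<partial>P) - step_loss / real (T - t)
    \<le> expected_gain t + (\<integral>I. fluid (T - Suc t) (cap I (Suc t)) \<partial>P)"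
proof -
  define \<phi> where "\<phi> b q = gain (Suc t) b q + fluid (T - Suc t) (step (Suc t) b q)" for b q
  have meas: "(\<lambda>(b, q). \<phi> b q) \<in> borel_measurable (borel \<Otimes>\<^sub>M borel \<Otimes>\<^sub>M borel)"
    unfolding \<phi>_def split_beta' using t
    by (intro borel_measurable_add gain_measurable fluid_measurable step_measurable) auto
  have bound: "\<bar>\<phi> b q\<bar> \<le> rM + real (T - Suc t) * rM" if "admissible b" "regular_request q" for b q
    using gain_bounds[OF that(2), of "Suc t" b] fluid_bounds[of "T - Suc t" "step (Suc t) b q"]
    unfolding \<phi>_def by linarith
  note fresh = fresh_request[OF t meas bound]
  have "(\<integral>I. fluid (T - t) (cap I t) \<partial>P) - step_loss / real (T - t)
      = (\<integral>I. fluid (T - t) (cap I t) - step_loss / real (T - t) \<partial>P)"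
    using fluid_integrable[of t "T - t"] t by simp
  also have "\<dots> \<le> (\<integral>I. \<integral>q. \<phi> (cap I t) q \<partial>Q \<partial>P)"
  proof (rule integral_mono_AE)
    show "AE I in P. fluid (T - t) (cap I t) - step_loss / real (T - t) \<le> (\<integral>q. \<phi> (cap I t) q \<partial>Q)"
      using AE_regular_requests
    proof eventually_elim
      case (elim I)
      then have "admissible (cap I t)" using t by (intro admissible_cap) auto
      from step_bound[OF t refl N this] show ?case unfolding \<phi>_def by simp
    qed
  qed (use fresh(2) fluid_integrable[of t "T - t"] t in auto)
  also have "\<dots> = (\<integral>I. \<phi> (cap I t) (I (Suc t)) \<partial>P)" using fresh(3) by simp
  also have "\<dots> = expected_gain t + (\<integral>I. fluid (T - Suc t) (cap I (Suc t)) \<partial>P)"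
    unfolding \<phi>_def cap_Suc[symmetric] expected_gain_def
    using gain_integrable[OF t] fluid_integrable[of "Suc t" "T - Suc t"] t by (intro Bochner_Integration.integral_add) auto
  finally show ?thesis .
qed

lemma expected_fluid_telescope:
  assumes "n \<le> T - N" "N \<le> T"
  shows "fluid T c \<le> (\<Sum>t<n. expected_gain t) + step_loss * (\<Sum>t<n. 1 / real (T - t))
    + (\<integral>I. fluid (T - n) (cap I n) \<partial>P)"
  using assms
proof (induction n)
  case 0
  then show ?case by simp
next
  case (Suc n)
  then have "n < T" "N < T - n" by auto
  from expected_fluid_step[OF this] Suc show ?case by (simp add: distrib_left)
qed

lemma harmonic_le: "n \<le> T \<Longrightarrow> (\<Sum>t<n. 1 / real (T - t)) \<le> ln (real T) + 1"
proof -
  assume "n \<le> T"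
  then have "(\<Sum>t<n. 1 / real (T - t)) \<le> (\<Sum>t<T. 1 / real (T - t))"
    by (intro sum_mono2) auto
  also have "\<dots> = (\<Sum>t<T. 1 / real (Suc (T - Suc t)))"
    by (intro sum.cong) (auto simp: Suc_diff_Suc)
  also have "\<dots> = (\<Sum>t<T. 1 / real (Suc t))" by (rule sum.nat_diff_reindex)
  also have "\<dots> = harm T" by (simp add: harm_altdef inverse_eq_divide)
  also have "\<dots> \<le> ln (real T) + 1"
    using decseqD[OF decseq_harm_diff_ln, of 0 "T - 1"] T_pos by (simp add: harm_Suc harm_def)
  finally show ?thesis .
qed

lemma expected_value_ATP2:
  "(\<integral>I. allocation_value m T I (ATP2 \<mu> J c I) \<partial>P) = (\<Sum>t<T. expected_gain t)"
  unfolding allocation_value_ATP2 expected_gain_def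
  by (intro Bochner_Integration.integral_sum gain_integrable) auto

text \<open>
  Summing the losses of the periods with more than \<open>N\<close> periods left gives the harmonic sum; the
  potential of the last \<open>N\<close> periods is at most \<open>N * rM\<close>.
\<close>
lemma fluid_minus_ATP2_le:
  assumes "N \<le> T"
  shows "fluid T c - (\<integral>I. allocation_value m T I (ATP2 \<mu> J c I) \<partial>P)
    \<le> step_loss * (ln (real T) + 1) + real N * rM"
proof -
  define n where "n = T - N"
  have Tn: "T - n = N" using assms by (simp add: n_def)
  have "fluid T c \<le> (\<Sum>t<n. expected_gain t) + step_loss * (\<Sum>t<n. 1 / real (T - t))
      + (\<integral>I. fluid N (cap I n) \<partial>P)"
    using expected_fluid_telescope[of n] assms unfolding Tn by (simp add: n_def)
  moreover have "(\<Sum>t<n. expected_gain t) \<le> (\<Sum>t<T. expected_gain t)"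
    using expected_gain_nonneg by (intro sum_mono2) (auto simp: n_def)
  moreover have "step_loss * (\<Sum>t<n. 1 / real (T - t)) \<le> step_loss * (ln (real T) + 1)"
    using harmonic_le[of n] M_gt_1 rM_pos by (intro mult_left_mono) (auto simp: n_def)
  moreover have "(\<integral>I. fluid N (cap I n) \<partial>P) \<le> (\<integral>I. real N * rM \<partial>P)"
    using fluid_bounds[of N] rM_pos by (intro integral_mono') auto
  ultimately show ?thesis unfolding expected_value_ATP2 by simp
qed

end

section \<open>The prophet and the regret\<close>

text \<open>
  The values of the feasible allocations form a nonempty finite set, since a value depends on the
  set of served pairs of period and resource only; so \<open>Max\<close> is a true maximum.
\<close>
lemma prophet_value_le:
  assumes c: "\<forall>j<m. 0 \<le> c j"
    and bound: "\<And>x. feasible_allocation m T c I x \<Longrightarrow> allocation_value m T I x \<le> B"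
  shows "prophet_value m T c I \<le> B"
proof -
  define V where "V = {allocation_value m T I x |x. feasible_allocation m T c I x}"
  define val where "val s = (\<Sum>t=1..T. \<Sum>j<m. fst (I t) * of_bool ((t, j) \<in> s))" for s :: "(nat \<times> nat) set"
  have "V \<subseteq> val ` Pow ({1..T} \<times> {..<m})"
  proof
    fix v assume "v \<in> V"
    then obtain x where x: "feasible_allocation m T c I x" "v = allocation_value m T I x"
      by (auto simp: V_def)
    have "x t j = of_bool ((t, j) \<in> {(t, j). x t j = 1} \<inter> {1..T} \<times> {..<m})" if "t \<in> {1..T}" "j < m" for t j
      using x(1) that by (fastforce simp: feasible_allocation_def)
    then have "v = val ({(t, j). x t j = 1} \<inter> {1..T} \<times> {..<m})"
      unfolding x(2) val_def allocation_value_def by (intro sum.cong refl arg_cong2[where f = "(*)"]) auto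
    then show "v \<in> val ` Pow ({1..T} \<times> {..<m})" by blast
  qed
  then have "finite V" by (rule finite_subset) simp
  moreover have "feasible_allocation m T c I (\<lambda>_ _. 0)"
    using c by (simp add: feasible_allocation_def)
  then have "V \<noteq> {}" by (auto simp: V_def)
  ultimately show ?thesis
    unfolding prophet_value_def V_def[symmetric] using bound by (subst Max_le_iff) (auto simp: V_def)
qed

text \<open>
  Weak duality: at a common price \<open>y\<close> per unit of capacity a request is worth at most
  \<open>max 0 (reward - y * size)\<close>, and the whole capacity is worth \<open>y\<close> times its total.
\<close>
lemma prophet_value_le_lagrangian:
  fixes y :: real
  assumes c: "\<forall>j<m. 0 \<le> c j" and y: "0 \<le> y"
  shows "prophet_value m T c I \<le> (\<Sum>t=1..T. max 0 (fst (I t) - y * snd (I t))) + y * (\<Sum>j<m. c j)"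
proof (rule prophet_value_le[OF c])
  fix x assume x: "feasible_allocation m T c I x"
  define z where "z t = (\<Sum>j<m. x t j)" for t
  have z: "0 \<le> z t" "z t \<le> 1" if "t \<in> {1..T}" for t
  proof -
    have "0 \<le> x t j" if "j < m" for j
    proof -
      have "x t j \<in> {0, 1}" using x \<open>t \<in> {1..T}\<close> that unfolding feasible_allocation_def by blast
      then show ?thesis by auto
    qed
    then show "0 \<le> z t" unfolding z_def by (intro sum_nonneg) auto
    show "z t \<le> 1" using x that by (simp add: feasible_allocation_def z_def)
  qed
  have "(\<Sum>t=1..T. snd (I t) * z t) = (\<Sum>j<m. \<Sum>t=1..T. snd (I t) * x t j)"
    unfolding z_def sum_distrib_left by (rule sum.swap)
  also have "\<dots> \<le> (\<Sum>j<m. c j)"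
    using x by (intro sum_mono) (auto simp: feasible_allocation_def)
  finally have used: "(\<Sum>t=1..T. snd (I t) * z t) \<le> (\<Sum>j<m. c j)" .
  have "allocation_value m T I x = (\<Sum>t=1..T. (fst (I t) - y * snd (I t)) * z t) + y * (\<Sum>t=1..T. snd (I t) * z t)"
    unfolding allocation_value_def sum_distrib_left[symmetric] z_def[symmetric]
    by (simp add: sum_distrib_left sum.distrib[symmetric] algebra_simps)
  also have "\<dots> \<le> (\<Sum>t=1..T. max 0 (fst (I t) - y * snd (I t))) + y * (\<Sum>j<m. c j)"
  proof (intro add_mono sum_mono mult_left_mono used y)
    fix t assume "t \<in> {1..T}"
    then have "(fst (I t) - y * snd (I t)) * z t \<le> max 0 (fst (I t) - y * snd (I t)) * z t"
      using z by (intro mult_right_mono) auto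
    also have "\<dots> \<le> max 0 (fst (I t) - y * snd (I t)) * 1"
      using z \<open>t \<in> {1..T}\<close> by (intro mult_left_mono) auto
    finally show "(fst (I t) - y * snd (I t)) * z t \<le> max 0 (fst (I t) - y * snd (I t))" by simp
  qed
  finally show "allocation_value m T I x \<le> (\<Sum>t=1..T. max 0 (fst (I t) - y * snd (I t))) + y * (\<Sum>j<m. c j)" .
qed

context atp2_run
begin

lemma expected_prophet_le_rewards: "(\<integral>I. prophet_value m T c I \<partial>P) \<le> real T * rM"
proof -
  have "(\<integral>I. prophet_value m T c I \<partial>P) \<le> (\<integral>I. real T * rM \<partial>P)"
  proof (rule integral_mono_AE')
    show "AE I in P. prophet_value m T c I \<le> real T * rM"
      using AE_regular_requests
    proof eventually_elim
      case (elim I)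
      have "prophet_value m T c I \<le> (\<Sum>t=1..T. max 0 (fst (I t)))"
        using prophet_value_le_lagrangian[of m c 0 T I] c_nonneg by simp
      also have "\<dots> \<le> (\<Sum>t=1..T. rM)"
        using elim rM_pos by (intro sum_mono) (auto simp: regular_request_def)
      finally show ?case by simp
    qed
  qed (use rM_pos in auto)
  then show ?thesis by simp
qed

text \<open>
  With the price \<open>1 / x\<close>, where \<open>x\<close> is the multiplier of the budget \<open>stock c / T\<close>, a request is
  profitable exactly if it passes the threshold \<open>r * x\<close>. The expected consumption of these
  requests is the budget, so the price terms cancel and only their reward \<open>T * G x\<close> remains.
\<close>
lemma expected_prophet_le_fluid:
  assumes N: "N < T"
  shows "(\<integral>I. prophet_value m T c I \<partial>P) \<le> fluid T c"
proof (cases "stock c = 0")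
  case True
  have "(\<integral>I. prophet_value m T c I \<partial>P) \<le> (\<integral>I. 0 \<partial>P)"
  proof (rule integral_mono_AE')
    show "AE I in P. prophet_value m T c I \<le> 0"
      using AE_regular_requests
    proof eventually_elim
      case (elim I)
      \<comment> \<open>Without capacity the price is free, and this one makes every request unprofitable.\<close>
      define y where "y = (\<Sum>t=1..T. fst (I t) / snd (I t))"
      have nonneg: "0 \<le> fst (I t) / snd (I t)" if "t \<in> {1..T}" for t
        using bspec[OF elim that] by (simp add: regular_request_def)
      have "max 0 (fst (I t) - y * snd (I t)) = 0" if t: "t \<in> {1..T}" for t
      proof -
        have "fst (I t) / snd (I t) \<le> y"
          unfolding y_def by (rule member_le_sum[OF t]) (use nonneg in auto)
        then show ?thesis using bspec[OF elim t] by (simp add: regular_request_def field_simps)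
      qed
      moreover have "0 \<le> y" unfolding y_def by (intro sum_nonneg nonneg)
      ultimately show ?case
        using prophet_value_le_lagrangian[of m c y T I] c_nonneg True by simp
    qed
  qed auto
  then show ?thesis using fluid_bounds(1)[of T c] by simp
next
  case False
  then have C: "0 < stock c" using sum_nonneg[of "{..<m}" c] c_nonneg by force
  let ?R = "mean_consumption p r S"
  have "stock c \<le> real N * ?R X" by (rule stock_c_le)
  also have "\<dots> \<le> real T * ?R X" using N consumption_pos by (intro mult_right_mono) auto
  finally have "stock c / real T \<le> ?R X" using T_pos by (simp add: field_simps)
  then obtain x where x: "0 \<le> x" "x \<le> X" "?R x = stock c / real T"
    using obtain_multiplier[of "stock c / real T"] C by auto
  then have x0: "0 < x" using C T_pos R_0 by (cases "x = 0") auto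
  define h where "h q = max 0 (fst q - 1 / x * snd q)" for q :: request
  have h_below: "h q = fst q * below x q - 1 / x * (snd q * below x q)" for q
    using x0 by (auto simp: h_def below_def field_simps)
  have h_mean: "(\<integral>q. h q \<partial>Q) = mean_reward p r S x - 1 / x * ?R x"
    unfolding h_below using reward_below[OF x(1)] size_below[OF x(1)] by simp
  have h_meas [measurable]: "h \<in> borel_measurable (borel \<Otimes>\<^sub>M borel)"
    unfolding h_def by measurable
  have h_bound: "\<bar>h q\<bar> \<le> rM" if "regular_request q" for q
  proof -
    have "0 \<le> 1 / x * snd q" using that x0 by (simp add: regular_request_def)
    then show ?thesis using that rM_pos unfolding h_def regular_request_def by linarith
  qed
  have h_period: "integrable P (\<lambda>I. h (I t))" "(\<integral>I. h (I t) \<partial>P) = (\<integral>q. h q \<partial>Q)" if t: "t \<in> {1..T}" for t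
  proof -
    have t': "t - 1 < T" "Suc (t - 1) = t" using t by auto
    have "(\<lambda>(b :: nat \<Rightarrow> real, q). h q) \<in> borel_measurable (borel \<Otimes>\<^sub>M borel \<Otimes>\<^sub>M borel)"
      by measurable
    note fresh = fresh_request[OF t'(1) this h_bound, unfolded t'(2)]
    show "integrable P (\<lambda>I. h (I t))" by (rule fresh(1))
    show "(\<integral>I. h (I t) \<partial>P) = (\<integral>q. h q \<partial>Q)" using fresh(3) by simp
  qed
  \<comment> \<open>The comparison rests on the integrability of the nonnegative upper bound: a non-integrable
    left side would have the integral 0.\<close>
  have "(\<integral>I. prophet_value m T c I \<partial>P) \<le> (\<integral>I. (\<Sum>t=1..T. h (I t)) + 1 / x * stock c \<partial>P)"
  proof (rule integral_mono')
    show "integrable P (\<lambda>I. (\<Sum>t=1..T. h (I t)) + 1 / x * stock c)"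
      using h_period(1) by (intro Bochner_Integration.integrable_add Bochner_Integration.integrable_sum) auto
    fix I
    show "prophet_value m T c I \<le> (\<Sum>t=1..T. h (I t)) + 1 / x * stock c"
      unfolding h_def using x0 c_nonneg by (intro prophet_value_le_lagrangian) auto
    show "0 \<le> (\<Sum>t=1..T. h (I t)) + 1 / x * stock c"
      using x0 C by (intro add_nonneg_nonneg sum_nonneg) (auto simp: h_def)
  qed
  also have "\<dots> = (\<Sum>t=1..T. \<integral>I. h (I t) \<partial>P) + 1 / x * stock c"
    using h_period(1) by (subst Bochner_Integration.integral_add) (auto intro!: Bochner_Integration.integral_sum)
  also have "\<dots> = real T * (\<integral>q. h q \<partial>Q) + 1 / x * stock c"
    using h_period(2) by simp
  also have "\<dots> = real T * mean_reward p r S x"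
    unfolding h_mean x(3) using T_pos x0 by (simp add: field_simps)
  also have "\<dots> = fluid T c"
    unfolding fluid_def x(3)[symmetric] using fluid_value_R[OF x(1,2)] by simp
  finally show ?thesis .
qed

lemma regret_ATP2_le:
  "regret (request_law p r S) m T c (ATP2 \<mu> J c)
    \<le> (ln (real T) + 1) * (2 * real m * M - real m) * rM + rM * real_of_int (K_hat p r S \<omega> m c)"
proof -
  let ?V = "\<integral>I. allocation_value m T I (ATP2 \<mu> J c I) \<partial>P"
  have "0 \<le> stock c / mean_consumption p r S X"
    using c_nonneg consumption_pos by (intro divide_nonneg_pos sum_nonneg) auto
  then have "0 \<le> K_hat p r S \<omega> m c" unfolding K_hat_def by linarith
  then have N: "real_of_int (K_hat p r S \<omega> m c) = real N" by (simp add: N_def)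
  have ln_nonneg: "0 \<le> ln (real T)" using T_pos by simp
  have "(ln (real T) + 1) * (2 * (M - 1) * real m * rM) \<le> (ln (real T) + 1) * ((2 * real m * M - real m) * rM)"
    using ln_nonneg rM_pos M_gt_1 by (intro mult_left_mono mult_right_mono) (auto simp: algebra_simps)
  then have log_term: "step_loss * (ln (real T) + 1) \<le> (ln (real T) + 1) * (2 * real m * M - real m) * rM"
    by (simp only: mult_ac)
  have step_nonneg: "0 \<le> step_loss * (ln (real T) + 1)"
    using ln_nonneg rM_pos M_gt_1 by simp
  have V_nonneg: "0 \<le> ?V"
    unfolding expected_value_ATP2 by (intro sum_nonneg expected_gain_nonneg) auto
  have "regret Q m T c (ATP2 \<mu> J c) = (\<integral>I. prophet_value m T c I \<partial>P) - ?V"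
    unfolding regret_def ..
  also have "\<dots> \<le> step_loss * (ln (real T) + 1) + real N * rM"
  proof (cases "N < T")
    case True
    then show ?thesis
      using expected_prophet_le_fluid fluid_minus_ATP2_le by force
  next
    case False
    then have "real T * rM \<le> real N * rM" using rM_pos by (intro mult_right_mono) auto
    then show ?thesis using expected_prophet_le_rewards step_nonneg V_nonneg by linarith
  qed
  finally show ?thesis using log_term unfolding N by (simp only: mult.commute[of rM])
qed

end

lemma regular_size_law_density:
  assumes "real_distribution N" "AE u in N. 0 < u" "regular_size_law \<omega> N"
  shows "\<exists>f l \<gamma>. positive_size N f \<and> 0 < l \<and> l < 1 \<and>
    (\<forall>w\<in>{0<..<\<omega>}. cdf N w \<le> \<gamma> * cdf N (l * w)) \<and> mono_on {0<..<\<omega>} (\<lambda>w. w ^ 3 * f w)"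
proof -
  from assms(3) obtain f l \<gamma> where f: "f \<in> borel_measurable borel" "\<forall>w. 0 \<le> f w"
      "N = density lborel (\<lambda>w. ennreal (f w))" "continuous_on {0<..} f"
    and rest: "0 < l" "l < 1" "\<forall>w\<in>{0<..<\<omega>}. cdf N w \<le> \<gamma> * cdf N (l * w)"
      "mono_on {0<..<\<omega>} (\<lambda>w. w ^ 3 * f w)"
    unfolding regular_size_law_def by blast
  have "positive_size N f"
    unfolding positive_size_def positive_size_axioms_def using assms(1,2) f by blast
  with rest show ?thesis by blast
qed

theorem theorem4:
  fixes p :: "'n::finite pmf"
    and r :: "'n \<Rightarrow> real"
    and S :: "'n \<Rightarrow> real measure"
    and \<omega> M :: real
  assumes "\<And>i. 0 \<le> r i"
    and "\<And>i. real_distribution (S i)"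
    and "\<And>i. AE u in S i. 0 < u"
    and "0 < \<omega>"
    and "\<And>i. regular_size_law \<omega> (S i)"
    and "1 < M"
    and "\<And>i w1 w2. 0 < w1 \<Longrightarrow> w1 < w2 \<Longrightarrow> w2 < \<omega> \<Longrightarrow>
           w2 * (cdf (S i) w2 - cdf (S i) w1) / (LINT w:{w1..w2}|S i. w) \<le> M"
    and "0 < mean_consumption p r S (\<omega> / r_max r)"
  shows "(\<forall>m T c \<mu> J. 1 \<le> m \<longrightarrow> 1 \<le> T \<longrightarrow> (\<forall>j<m. 0 \<le> c j) \<longrightarrow>
            ATP2_multiplier p r S m T \<mu> \<longrightarrow> largest_resource m T J \<longrightarrow>
            regret (request_law p r S) m T c (ATP2 \<mu> J c)
              \<le> (ln (real T) + 1) * (2 * real m * M - real m) * r_max r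
                + r_max r * real_of_int (K_hat p r S \<omega> m c)) \<and>
         (\<forall>cmax. \<exists>C. \<forall>m T c. 1 \<le> m \<longrightarrow> 2 \<le> T \<longrightarrow> (\<forall>j<m. 0 \<le> c j \<and> c j \<le> cmax) \<longrightarrow>
            (ln (real T) + 1) * (2 * real m * M - real m) * r_max r
              + r_max r * real_of_int (K_hat p r S \<omega> m c)
              \<le> C * (real m * ln (real T)))"
proof -
  have "\<forall>i. \<exists>f l \<gamma>. positive_size (S i) f \<and> 0 < l \<and> l < 1 \<and>
    (\<forall>w\<in>{0<..<\<omega>}. cdf (S i) w \<le> \<gamma> * cdf (S i) (l * w)) \<and> mono_on {0<..<\<omega>} (\<lambda>w. w ^ 3 * f w)"
    using regular_size_law_density assms(2,3,5) by blast
  from choice[OF this] obtain f where "\<forall>i. \<exists>l \<gamma>. positive_size (S i) (f i) \<and> 0 < l \<and> l < 1 \<and>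
    (\<forall>w\<in>{0<..<\<omega>}. cdf (S i) w \<le> \<gamma> * cdf (S i) (l * w)) \<and> mono_on {0<..<\<omega>} (\<lambda>w. w ^ 3 * f i w)" ..
  from choice[OF this] obtain l where "\<forall>i. \<exists>\<gamma>. positive_size (S i) (f i) \<and> 0 < l i \<and> l i < 1 \<and>
    (\<forall>w\<in>{0<..<\<omega>}. cdf (S i) w \<le> \<gamma> * cdf (S i) (l i * w)) \<and> mono_on {0<..<\<omega>} (\<lambda>w. w ^ 3 * f i w)" ..
  from choice[OF this] obtain \<gamma> where *: "\<forall>i. positive_size (S i) (f i) \<and> 0 < l i \<and> l i < 1 \<and>
    (\<forall>w\<in>{0<..<\<omega>}. cdf (S i) w \<le> \<gamma> i * cdf (S i) (l i * w)) \<and> mono_on {0<..<\<omega>} (\<lambda>w. w ^ 3 * f i w)" ..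
  interpret request_classes p r S f l \<gamma> \<omega> M
    by (rule request_classes.intro) (simp_all add: assms *)
  let ?R = "mean_consumption p r S X"
  have "regret (request_law p r S) m T c (ATP2 \<mu> J c)
      \<le> (ln (real T) + 1) * (2 * real m * M - real m) * rM + rM * real_of_int (K_hat p r S \<omega> m c)"
    if "1 \<le> m" "1 \<le> T" "\<forall>j<m. 0 \<le> c j" "ATP2_multiplier p r S m T \<mu>" "largest_resource m T J"
    for m T c \<mu> J
  proof -
    interpret atp2_run p r S f l \<gamma> \<omega> M m T c \<mu> J
      by unfold_locales (use that in auto)
    show ?thesis by (rule regret_ATP2_le)
  qed
  moreover have "\<exists>C. \<forall>m T c. 1 \<le> m \<longrightarrow> 2 \<le> T \<longrightarrow> (\<forall>j<m. 0 \<le> c j \<and> c j \<le> cmax) \<longrightarrow>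
      (ln (real T) + 1) * (2 * real m * M - real m) * rM + rM * real_of_int (K_hat p r S \<omega> m c)
        \<le> C * (real m * ln (real T))" for cmax
  proof (intro exI allI impI)
    fix m T :: nat and c :: "nat \<Rightarrow> real"
    assume m: "1 \<le> m" and T: "2 \<le> T" and c: "\<forall>j<m. 0 \<le> c j \<and> c j \<le> cmax"
    \<comment> \<open>\<open>K_hat\<close> is at most linear in \<open>m\<close> since each capacity is at most \<open>cmax\<close>, and \<open>L \<ge> ln 2\<close> turns
      constants into multiples of \<open>L\<close>.\<close>
    define L where "L = ln (real T)"
    have "ln 2 \<le> L" using T by (simp add: L_def)
    moreover have ln2: "0 < ln (2::real)" by simp
    ultimately have L: "1 \<le> L / ln 2" by simp
    have "0 \<le> cmax" using c m by (meson less_le_trans order_trans zero_less_one)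
    have "(\<Sum>j<m. c j) \<le> real m * cmax" using sum_bounded_above[of "{..<m}" c cmax] c by simp
    then have "(\<Sum>j<m. c j) / ?R \<le> real m * cmax / ?R"
      using consumption_pos by (intro divide_right_mono) auto
    then have "real_of_int (K_hat p r S \<omega> m c) \<le> real m * cmax / ?R + 1"
      unfolding K_hat_def by linarith
    also have "\<dots> \<le> real m * (cmax / ?R + 1)" using m by (simp add: distrib_left)
    also have "\<dots> \<le> real m * (cmax / ?R + 1) * (L / ln 2)"
      using mult_left_mono[OF L, of "real m * (cmax / ?R + 1)"] \<open>0 \<le> cmax\<close> consumption_pos by simp
    finally have "rM * real_of_int (K_hat p r S \<omega> m c) \<le> rM * (real m * (cmax / ?R + 1) * (L / ln 2))"
      using rM_pos by (intro mult_left_mono) auto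
    moreover have "(L + 1) * (2 * real m * M - real m) * rM \<le> (L + L / ln 2) * (2 * real m * M - real m) * rM"
    proof (intro mult_right_mono add_left_mono L)
      have "real m * 1 \<le> real m * (2 * M)" using M_gt_1 by (intro mult_left_mono) auto
      then show "0 \<le> 2 * real m * M - real m" by simp
    qed (use rM_pos in simp)
    ultimately have "(L + 1) * (2 * real m * M - real m) * rM + rM * real_of_int (K_hat p r S \<omega> m c)
        \<le> (L + L / ln 2) * (2 * real m * M - real m) * rM + rM * (real m * (cmax / ?R + 1) * (L / ln 2))"
      by linarith
    also have "\<dots> = ((1 + 1 / ln 2) * (2 * M - 1) * rM + rM * (cmax / ?R + 1) / ln 2) * (real m * L)"
      by (simp add: algebra_simps add_divide_distrib diff_divide_distrib)
    finally show "(ln (real T) + 1) * (2 * real m * M - real m) * rM + rM * real_of_int (K_hat p r S \<omega> m c)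
        \<le> ((1 + 1 / ln 2) * (2 * M - 1) * rM + rM * (cmax / ?R + 1) / ln 2) * (real m * ln (real T))"
      unfolding L_def .
  qed
  ultimately show ?thesis by blast
qed

end
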